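(* Let $\phi$ be a frugal monodic standpoint $\mathcal{C}^2$ sentence over the signature $\langle\mathbf{P},\emptyset,\{*\}\rangle$, let $\ell=|\mathit{FreeDia}_\phi|$ and $m=\lceil |\mathit{Dia}_\phi| + \log_2(|\mathit{Dia}_\phi|)\rceil$. Then $\phi$ is satisfiable if and only if the plain $\mathcal{C}^2$ sentence $\phi^m_{\mathrm{stack}}\wedge\phi^\ell_{\mathrm{rig}\mathtt{E}}\wedge \mathsf{Trans}_m(\phi)$ is satisfiable.
   Context: FOSL: signature $\langle\mathbf{P},\mathbf{C},\mathbf{S}\rangle$ with $*\in\mathbf{S}$; formulae $\phi ::= P(t_1,\dots,t_k)\mid t_1\doteq t_2\mid\neg\phi\mid\phi\wedge\psi\mid\exists^{\lhd n}x.\phi\mid\Diamond_e\phi$ ($\lhd\in\{\le,=,\ge\}$; $\forall x.\phi$ abbreviates $\exists^{=0}x.\neg\phi$, $\exists x$ abbreviates $\exists^{\ge1}x$), standpoint expressions $e$ built from standpoint symbols by $\cap,\cup,\setminus$. Standpoint structures $\langle\Delta,\Pi,\sigma,\gamma\rangle$: nonempty domain, nonempty set of precisifications, $\sigma( * )=\Pi$, $\gamma(\pi)$ a first-order structure over $\Delta$; $\Diamond_e\phi$ holds at $\pi$ under $v$ iff $\phi$ holds at some $\pi'\in\sigma(e)$ under $v$; quantifiers range over $\Delta$ within the current precisification; a model satisfies the formula at every precisification under every assignment. A formula is frugal monodic standpoint $\mathcal{C}^2$ if it uses only variables $x,y$, predicates of arity 1 or 2 (no nullary predicates), no constants, the only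 standpoint expression $*$, and in every subformula $\Diamond_*\psi$, $\psi$ has at most one free variable. $\mathit{Dia}_\phi$ is the set of subformulae of $\phi$ of the form $\Diamond_*\psi$, and $\mathit{FreeDia}_\phi$ those with exactly one free variable. Let $\mathtt{E}_0,\dots,\mathtt{E}_\ell,\mathtt{L}_0,\dots,\mathtt{L}_{m-1}$ be fresh unary and $\mathtt{F}$ a fresh binary predicate. $\phi^m_{\mathrm{stack}}$ is the conjunction of: (F1) $\forall x.(\bigvee_{0\le j<m}\neg\mathtt{L}_j(x))\to\exists^{=1}y.\mathtt{F}(x,y)$; (F2) $\forall x.(\bigwedge_{0\le j<m}\mathtt{L}_j(x))\to\exists^{=0}y.\mathtt{F}(x,y)$; (F3) $\forall x.(\bigvee_{0\le j<m}\mathtt{L}_j(x))\to\exists^{=1}y.\mathtt{F}(y,x)$; (F4) $\forall x.(\bigwedge_{0\le j<m}\neg\mathtt{L}_j(x))\to\exists^{=0}y.\mathtt{F}(y,x)$; (F5) $\forall x\forall y.\mathtt{F}(x,y)\to\bigwedge_{0\le j<m}\big((\mathtt{L}_j(x)\leftrightarrow\mathtt{L}_j(y))\leftrightarrow\bigvee_{0\le j'<j}\neg\mathtt{L}_{j'}(x)\big)$; (F6) for each binary $P\in\mathbf{P}$, $\forall x\forall y.P(x,y)\to\bigwedge_{0\le j<m}(\mathtt{L}_j(x)\leftrightarrow\mathtt{L}_j(y))$. $\phi^\ell_{\mathrm{rig}\mathtt{E}}$ is $\forall x.\forall y.\mathtt{F}(x,y)\to\bigwedge_{0\le i\le\ell}(\mathtt{E}_i(x)\leftrightarrow\mathtt{E}_i(y))$.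 $\mathsf{Trans}_m(\phi)$ is $\forall x.\forall y.(x\doteq y\to\mathsf{tr}(\phi))$, where $\mathsf{tr}$ is the identity on atoms $P(z)$, $P(z,z')$, $z\doteq z'$, commutes with $\neg$ and $\wedge$, maps $\exists^{\lhd n}z.\psi$ to $\exists^{\lhd n}z.(\phi^=_{\mathtt{L}}(x,y)\wedge\mathsf{tr}(\psi))$, and maps $\Diamond_*\psi$ to $\forall z_{\mathrm{nf}}.(x\doteq y\to\exists z_{\mathrm{mf}}.(\phi^=_{\mathtt{E}}(x,y)\wedge\mathsf{tr}(\psi)))$, where $z_{\mathrm{nf}}\in\{x,y\}$ is not free in $\psi$ and $z_{\mathrm{mf}}$ is the other variable; here $\phi^=_{\mathtt{L}}(x,y)=\bigwedge_{0\le j<m}(\mathtt{L}_j(x)\leftrightarrow\mathtt{L}_j(y))$ and $\phi^=_{\mathtt{E}}(x,y)=\bigwedge_{0\le i\le\ell}(\mathtt{E}_i(x)\leftrightarrow\mathtt{E}_i(y))$. Plain $\mathcal{C}^2$ sentences are evaluated in ordinary first-order interpretations.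
   Formalization: Trans_m is applied to φ with bound variables renamed so that outermost quantifiers in a diamond's body bind z_nf (fixed as y for closed bodies); otherwise the claim fails, e.g. for (∃x.◇(P(x)∧∃x.Q(x)))∧(∃x.◇(P(x)∧¬∃y.Q(y))). P is finite; m=0 if there are no diamonds. *)

theory Defs
  imports Complex_Main
begin

section \<open>Syntax of first-order standpoint logic\<close>

datatype var = X | Y | V nat

datatype 'c tm = Var var | Con 'c

datatype cmp = AtMost | Exactly | AtLeast

text \<open>\<open>Star\<close> is the distinguished universal standpoint symbol; a set of standpoint symbols is
  expected to contain it.\<close>

datatype 's stp = Star | Named 's

datatype 's sexpr =
    Sym "'s stp"
  | SInter "'s sexpr" "'s sexpr"
  | SUnion "'s sexpr" "'s sexpr"
  | SDiff "'s sexpr" "'s sexpr"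

datatype ('p, 'c, 's) fm =
    Atom 'p "'c tm list"
  | Equal "'c tm" "'c tm"
  | Neg "('p, 'c, 's) fm"
  | Conj "('p, 'c, 's) fm" "('p, 'c, 's) fm"
  | Count cmp nat var "('p, 'c, 's) fm"
  | Dia "'s sexpr" "('p, 'c, 's) fm"

record ('p, 'c) fo_sig =
  preds :: "'p set"
  arity :: "'p \<Rightarrow> nat"
  cnsts :: "'c set"

record ('p, 'c, 's) sp_sig = "('p, 'c) fo_sig" +
  stps :: "'s stp set"

primrec tm_vars :: "'c tm \<Rightarrow> var set" where
  "tm_vars (Var z) = {z}"
| "tm_vars (Con c) = {}"

primrec tm_consts :: "'c tm \<Rightarrow> 'c set" where
  "tm_consts (Var z) = {}"
| "tm_consts (Con c) = {c}"

primrec sexpr_syms :: "'s sexpr \<Rightarrow> 's stp set" where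
  "sexpr_syms (Sym s) = {s}"
| "sexpr_syms (SInter e f) = sexpr_syms e \<union> sexpr_syms f"
| "sexpr_syms (SUnion e f) = sexpr_syms e \<union> sexpr_syms f"
| "sexpr_syms (SDiff e f) = sexpr_syms e \<union> sexpr_syms f"

primrec wf_fm :: "('p, 'c, 's) sp_sig \<Rightarrow> ('p, 'c, 's) fm \<Rightarrow> bool" where
  "wf_fm S (Atom p ts) \<longleftrightarrow>
     p \<in> preds S \<and> length ts = arity S p \<and> (\<forall>t\<in>set ts. tm_consts t \<subseteq> cnsts S)"
| "wf_fm S (Equal s t) \<longleftrightarrow> tm_consts s \<subseteq> cnsts S \<and> tm_consts t \<subseteq> cnsts S"
| "wf_fm S (Neg f) \<longleftrightarrow> wf_fm S f"
| "wf_fm S (Conj f g) \<longleftrightarrow> wf_fm S f \<and> wf_fm S g"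
| "wf_fm S (Count q n z f) \<longleftrightarrow> wf_fm S f"
| "wf_fm S (Dia e f) \<longleftrightarrow> sexpr_syms e \<subseteq> stps S \<and> wf_fm S f"

primrec fv :: "('p, 'c, 's) fm \<Rightarrow> var set" where
  "fv (Atom p ts) = (\<Union>t\<in>set ts. tm_vars t)"
| "fv (Equal s t) = tm_vars s \<union> tm_vars t"
| "fv (Neg f) = fv f"
| "fv (Conj f g) = fv f \<union> fv g"
| "fv (Count q n z f) = fv f - {z}"
| "fv (Dia e f) = fv f"

primrec vars :: "('p, 'c, 's) fm \<Rightarrow> var set" where
  "vars (Atom p ts) = (\<Union>t\<in>set ts. tm_vars t)"
| "vars (Equal s t) = tm_vars s \<union> tm_vars t"
| "vars (Neg f) = vars f"
| "vars (Conj f g) = vars f \<union> vars g"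
| "vars (Count q n z f) = insert z (vars f)"
| "vars (Dia e f) = vars f"

primrec subfms :: "('p, 'c, 's) fm \<Rightarrow> ('p, 'c, 's) fm set" where
  "subfms (Atom p ts) = {Atom p ts}"
| "subfms (Equal s t) = {Equal s t}"
| "subfms (Neg f) = insert (Neg f) (subfms f)"
| "subfms (Conj f g) = insert (Conj f g) (subfms f \<union> subfms g)"
| "subfms (Count q n z f) = insert (Count q n z f) (subfms f)"
| "subfms (Dia e f) = insert (Dia e f) (subfms f)"


section \<open>Semantics of first-order standpoint logic\<close>

record ('d, 'p, 'c) interp =
  idom :: "'d set"
  pint :: "'p \<Rightarrow> 'd list set"
  cint :: "'c \<Rightarrow> 'd"

definition wf_interp :: "('p, 'c, 'z) fo_sig_scheme \<Rightarrow> ('d, 'p, 'c) interp \<Rightarrow> bool" where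
  "wf_interp S I \<longleftrightarrow> idom I \<noteq> {} \<and>
     (\<forall>p\<in>preds S. pint I p \<subseteq> {ds. set ds \<subseteq> idom I \<and> length ds = arity S p}) \<and>
     (\<forall>c\<in>cnsts S. cint I c \<in> idom I)"

record ('d, 'w, 'p, 'c, 's) sp_struct =
  dom :: "'d set"
  precs :: "'w set"
  sigma :: "'s stp \<Rightarrow> 'w set"
  gamma :: "'w \<Rightarrow> ('d, 'p, 'c) interp"

definition wf_struct :: "('p, 'c, 's) sp_sig \<Rightarrow> ('d, 'w, 'p, 'c, 's) sp_struct \<Rightarrow> bool" where
  "wf_struct S M \<longleftrightarrow> dom M \<noteq> {} \<and> precs M \<noteq> {} \<and>
     (\<forall>s\<in>stps S. sigma M s \<subseteq> precs M) \<and> sigma M Star = precs M \<and>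
     (\<forall>\<pi>\<in>precs M. wf_interp S (gamma M \<pi>) \<and> idom (gamma M \<pi>) = dom M)"

primrec sext :: "('s stp \<Rightarrow> 'w set) \<Rightarrow> 's sexpr \<Rightarrow> 'w set" where
  "sext \<sigma> (Sym s) = \<sigma> s"
| "sext \<sigma> (SInter e f) = sext \<sigma> e \<inter> sext \<sigma> f"
| "sext \<sigma> (SUnion e f) = sext \<sigma> e \<union> sext \<sigma> f"
| "sext \<sigma> (SDiff e f) = sext \<sigma> e - sext \<sigma> f"

primrec tm_val :: "('d, 'p, 'c) interp \<Rightarrow> (var \<Rightarrow> 'd) \<Rightarrow> 'c tm \<Rightarrow> 'd" where
  "tm_val I v (Var z) = v z"
| "tm_val I v (Con c) = cint I c"

text \<open>Since \<^const>\<open>card\<close> is 0 on infinite sets, finiteness is made explicit.\<close>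

fun count_ok :: "cmp \<Rightarrow> nat \<Rightarrow> 'd set \<Rightarrow> bool" where
  "count_ok AtMost n D \<longleftrightarrow> finite D \<and> card D \<le> n"
| "count_ok Exactly n D \<longleftrightarrow> finite D \<and> card D = n"
| "count_ok AtLeast n D \<longleftrightarrow> infinite D \<or> card D \<ge> n"

primrec holds ::
  "('d, 'w, 'p, 'c, 's) sp_struct \<Rightarrow> 'w \<Rightarrow> (var \<Rightarrow> 'd) \<Rightarrow> ('p, 'c, 's) fm \<Rightarrow> bool" where
  "holds M \<pi> v (Atom p ts) \<longleftrightarrow> map (tm_val (gamma M \<pi>) v) ts \<in> pint (gamma M \<pi>) p"
| "holds M \<pi> v (Equal s t) \<longleftrightarrow> tm_val (gamma M \<pi>) v s = tm_val (gamma M \<pi>) v t"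
| "holds M \<pi> v (Neg f) \<longleftrightarrow> \<not> holds M \<pi> v f"
| "holds M \<pi> v (Conj f g) \<longleftrightarrow> holds M \<pi> v f \<and> holds M \<pi> v g"
| "holds M \<pi> v (Count q n z f) \<longleftrightarrow> count_ok q n {d \<in> dom M. holds M \<pi> (v(z := d)) f}"
| "holds M \<pi> v (Dia e f) \<longleftrightarrow> (\<exists>\<pi>'\<in>sext (sigma M) e. holds M \<pi>' v f)"

definition sp_models :: "('d, 'w, 'p, 'c, 's) sp_struct \<Rightarrow> ('p, 'c, 's) fm \<Rightarrow> bool" where
  "sp_models M f \<longleftrightarrow> (\<forall>\<pi>\<in>precs M. \<forall>v. range v \<subseteq> dom M \<longrightarrow> holds M \<pi> v f)"

text \<open>Satisfiability is relative to a type \<open>'u\<close> from which the elements of the domain and the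
  precisifications are drawn, as the logic cannot quantify over types. The domain and the set of
  precisifications are arbitrary nonempty subsets of \<open>'u\<close>. For \<open>'u\<close> ranging over all infinite
  types, this covers structures of every size.\<close>

definition sp_satisfiable :: "'u itself \<Rightarrow> ('p, 'c, 's) sp_sig \<Rightarrow> ('p, 'c, 's) fm \<Rightarrow> bool" where
  "sp_satisfiable T S f \<longleftrightarrow>
     (\<exists>M :: ('u, 'u, 'p, 'c, 's) sp_struct. wf_struct S M \<and> sp_models M f)"


section \<open>The frugal monodic two-variable fragment\<close>

definition frugal_monodic_C2 :: "('p, 'c, 's) sp_sig \<Rightarrow> ('p, 'c, 's) fm \<Rightarrow> bool" where
  "frugal_monodic_C2 S f \<longleftrightarrow>
     vars f \<subseteq> {X, Y} \<and>
     (\<forall>p ts. Atom p ts \<in> subfms f \<longrightarrow>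
        arity S p \<in> {1, 2} \<and> (\<forall>t\<in>set ts. tm_consts t = {})) \<and>
     (\<forall>s t. Equal s t \<in> subfms f \<longrightarrow> tm_consts s = {} \<and> tm_consts t = {}) \<and>
     (\<forall>e g. Dia e g \<in> subfms f \<longrightarrow> e = Sym Star \<and> card (fv g) \<le> 1)"

definition Dia_set :: "('p, 'c, 's) fm \<Rightarrow> ('p, 'c, 's) fm set" where
  "Dia_set f = {g \<in> subfms f. \<exists>h. g = Dia (Sym Star) h}"

definition FreeDia_set :: "('p, 'c, 's) fm \<Rightarrow> ('p, 'c, 's) fm set" where
  "FreeDia_set f = {g \<in> Dia_set f. card (fv g) = 1}"

text \<open>If there are no diamonds, the logarithm is undefined, and a single layer is used.\<close>

definition num_bits :: "('p, 'c, 's) fm \<Rightarrow> nat" where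
  "num_bits f =
     (let k = card (Dia_set f) in if k = 0 then 0 else nat \<lceil>real k + log 2 (real k)\<rceil>)"


section \<open>Plain first-order logic with counting\<close>

datatype ('p, 'c) fo =
    FAtom 'p "'c tm list"
  | FEqual "'c tm" "'c tm"
  | FNeg "('p, 'c) fo"
  | FConj "('p, 'c) fo" "('p, 'c) fo"
  | FCount cmp nat var "('p, 'c) fo"

primrec fo_holds :: "('d, 'p, 'c) interp \<Rightarrow> (var \<Rightarrow> 'd) \<Rightarrow> ('p, 'c) fo \<Rightarrow> bool" where
  "fo_holds I v (FAtom p ts) \<longleftrightarrow> map (tm_val I v) ts \<in> pint I p"
| "fo_holds I v (FEqual s t) \<longleftrightarrow> tm_val I v s = tm_val I v t"
| "fo_holds I v (FNeg f) \<longleftrightarrow> \<not> fo_holds I v f"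
| "fo_holds I v (FConj f g) \<longleftrightarrow> fo_holds I v f \<and> fo_holds I v g"
| "fo_holds I v (FCount q n z f) \<longleftrightarrow> count_ok q n {d \<in> idom I. fo_holds I (v(z := d)) f}"

definition fo_models :: "('d, 'p, 'c) interp \<Rightarrow> ('p, 'c) fo \<Rightarrow> bool" where
  "fo_models I f \<longleftrightarrow> (\<forall>v. range v \<subseteq> idom I \<longrightarrow> fo_holds I v f)"

definition fo_satisfiable :: "'u itself \<Rightarrow> ('p, 'c) fo_sig \<Rightarrow> ('p, 'c) fo \<Rightarrow> bool" where
  "fo_satisfiable T S f \<longleftrightarrow> (\<exists>I :: ('u, 'p, 'c) interp. wf_interp S I \<and> fo_models I f)"

abbreviation FDisj :: "('p, 'c) fo \<Rightarrow> ('p, 'c) fo \<Rightarrow> ('p, 'c) fo" where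
  "FDisj f g \<equiv> FNeg (FConj (FNeg f) (FNeg g))"

abbreviation FImp :: "('p, 'c) fo \<Rightarrow> ('p, 'c) fo \<Rightarrow> ('p, 'c) fo" where
  "FImp f g \<equiv> FNeg (FConj f (FNeg g))"

abbreviation FIff :: "('p, 'c) fo \<Rightarrow> ('p, 'c) fo \<Rightarrow> ('p, 'c) fo" where
  "FIff f g \<equiv> FConj (FImp f g) (FImp g f)"

abbreviation FAll :: "var \<Rightarrow> ('p, 'c) fo \<Rightarrow> ('p, 'c) fo" where
  "FAll z f \<equiv> FCount Exactly 0 z (FNeg f)"

abbreviation FEx :: "var \<Rightarrow> ('p, 'c) fo \<Rightarrow> ('p, 'c) fo" where
  "FEx z f \<equiv> FCount AtLeast 1 z f"

text \<open>A closed tautology, used for the empty conjunction.\<close>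

definition FTrue :: "('p, 'c) fo" where
  "FTrue = FCount AtLeast 0 X (FEqual (Var X) (Var X))"

definition FConjs :: "('p, 'c) fo list \<Rightarrow> ('p, 'c) fo" where
  "FConjs fs = foldr FConj fs FTrue"

definition FDisjs :: "('p, 'c) fo list \<Rightarrow> ('p, 'c) fo" where
  "FDisjs fs = foldr FDisj fs (FNeg FTrue)"


section \<open>The translation\<close>

text \<open>Using constructors for the additional predicates makes them fresh by construction.\<close>

datatype 'p xpred = Old 'p | E nat | L nat | F

fun xarity :: "('p \<Rightarrow> nat) \<Rightarrow> 'p xpred \<Rightarrow> nat" where
  "xarity ar (Old p) = ar p"
| "xarity ar (E i) = 1"
| "xarity ar (L j) = 1"
| "xarity ar F = 2"

definition xsig :: "nat \<Rightarrow> nat \<Rightarrow> ('p, 'c, 's) sp_sig \<Rightarrow> ('p xpred, 'c) fo_sig" where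
  "xsig l m S =
     \<lparr>preds = Old ` preds S \<union> E ` {..l} \<union> L ` {..<m} \<union> {F},
      arity = xarity (arity S),
      cnsts = cnsts S\<rparr>"

abbreviation EA :: "nat \<Rightarrow> var \<Rightarrow> ('p xpred, 'c) fo" where
  "EA i z \<equiv> FAtom (E i) [Var z]"

abbreviation LA :: "nat \<Rightarrow> var \<Rightarrow> ('p xpred, 'c) fo" where
  "LA j z \<equiv> FAtom (L j) [Var z]"

abbreviation FA :: "var \<Rightarrow> var \<Rightarrow> ('p xpred, 'c) fo" where
  "FA z z' \<equiv> FAtom F [Var z, Var z']"

definition eqL :: "nat \<Rightarrow> ('p xpred, 'c) fo" where
  "eqL m = FConjs (map (\<lambda>j. FIff (LA j X) (LA j Y)) [0..<m])"

definition eqE :: "nat \<Rightarrow> ('p xpred, 'c) fo" where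
  "eqE l = FConjs (map (\<lambda>i. FIff (EA i X) (EA i Y)) [0..<Suc l])"

text \<open>Finitely many binary predicates are assumed here; their order is immaterial.\<close>

definition binary_preds :: "('p, 'c, 's) sp_sig \<Rightarrow> 'p list" where
  "binary_preds S = (SOME ps. distinct ps \<and> set ps = {p \<in> preds S. arity S p = 2})"

definition stack :: "('p, 'c, 's) sp_sig \<Rightarrow> nat \<Rightarrow> ('p xpred, 'c) fo" where
  "stack S m = FConjs
    ([FAll X (FImp (FDisjs (map (\<lambda>j. FNeg (LA j X)) [0..<m])) (FCount Exactly 1 Y (FA X Y))),
      FAll X (FImp (FConjs (map (\<lambda>j. LA j X) [0..<m])) (FCount Exactly 0 Y (FA X Y))),
      FAll X (FImp (FDisjs (map (\<lambda>j. LA j X) [0..<m])) (FCount Exactly 1 Y (FA Y X))),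
      FAll X (FImp (FConjs (map (\<lambda>j. FNeg (LA j X)) [0..<m])) (FCount Exactly 0 Y (FA Y X))),
      FAll X (FAll Y (FImp (FA X Y)
        (FConjs (map (\<lambda>j. FIff (FIff (LA j X) (LA j Y))
          (FDisjs (map (\<lambda>j'. FNeg (LA j' X)) [0..<j]))) [0..<m]))))]
     @ map (\<lambda>p. FAll X (FAll Y (FImp (FAtom (Old p) [Var X, Var Y]) (eqL m)))) (binary_preds S))"

definition rigE :: "nat \<Rightarrow> ('p xpred, 'c) fo" where
  "rigE l = FAll X (FAll Y (FImp (FA X Y) (eqE l)))"

fun other :: "var \<Rightarrow> var" where
  "other X = Y"
| "other Y = X"
| "other (V n) = V n"

text \<open>For the body of a diamond, \<open>nf\<close> is a variable that is not free in it, and \<open>mf\<close> is the one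
  that may be free. For closed bodies, either choice would be possible.\<close>

definition nf :: "('p, 'c, 's) fm \<Rightarrow> var" where
  "nf f = (if Y \<notin> fv f then Y else X)"

definition mf :: "('p, 'c, 's) fm \<Rightarrow> var" where
  "mf f = other (nf f)"

primrec tr :: "nat \<Rightarrow> nat \<Rightarrow> ('p, 'c, 's) fm \<Rightarrow> ('p xpred, 'c) fo" where
  "tr l m (Atom p ts) = FAtom (Old p) ts"
| "tr l m (Equal s t) = FEqual s t"
| "tr l m (Neg f) = FNeg (tr l m f)"
| "tr l m (Conj f g) = FConj (tr l m f) (tr l m g)"
| "tr l m (Count q n z f) = FCount q n z (FConj (eqL m) (tr l m f))"
| "tr l m (Dia e f) =
     FAll (nf f) (FImp (FEqual (Var X) (Var Y)) (FEx (mf f) (FConj (eqE l) (tr l m f))))"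

definition Trans :: "nat \<Rightarrow> nat \<Rightarrow> ('p, 'c, 's) fm \<Rightarrow> ('p xpred, 'c) fo" where
  "Trans l m f = FAll X (FAll Y (FImp (FEqual (Var X) (Var Y)) (tr l m f)))"


section \<open>Naming of bound variables\<close>

text \<open>In the translation of a quantifier over \<open>z\<close>, the current value of \<open>other z\<close> determines the
  layer that \<open>z\<close> ranges over. Right after a diamond, only \<open>mf\<close> has been moved to the new layer. So a
  quantifier in the body of the diamond that is not in the scope of another quantifier must bind
  \<open>nf\<close>. The translation is meant for formulas whose bound variables are named in this way. It is
  not correct for, e.g., the body \<open>P(x) \<and> \<exists>x. Q(x)\<close>, in place of \<open>P(x) \<and> \<exists>y. Q(y)\<close>: it
  would evaluate the second conjunct in the old layer. Every formula of the fragment can be brought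
  into this form by renaming bound variables only, which \<open>rename\<close> does. It leaves formulas that
  are already in this form unchanged.\<close>

primrec outer_bound :: "('p, 'c, 's) fm \<Rightarrow> var set" where
  "outer_bound (Atom p ts) = {}"
| "outer_bound (Equal s t) = {}"
| "outer_bound (Neg f) = outer_bound f"
| "outer_bound (Conj f g) = outer_bound f \<union> outer_bound g"
| "outer_bound (Count q n z f) = {z}"
| "outer_bound (Dia e f) = {}"

definition well_named :: "('p, 'c, 's) fm \<Rightarrow> bool" where
  "well_named f \<longleftrightarrow> (\<forall>e g. Dia e g \<in> subfms f \<longrightarrow> mf g \<notin> outer_bound g)"

primrec swap_tm :: "'c tm \<Rightarrow> 'c tm" where
  "swap_tm (Var z) = Var (other z)"
| "swap_tm (Con c) = Con c"

primrec swap :: "('p, 'c, 's) fm \<Rightarrow> ('p, 'c, 's) fm" where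
  "swap (Atom p ts) = Atom p (map swap_tm ts)"
| "swap (Equal s t) = Equal (swap_tm s) (swap_tm t)"
| "swap (Neg f) = Neg (swap f)"
| "swap (Conj f g) = Conj (swap f) (swap g)"
| "swap (Count q n z f) = Count q n (other z) (swap f)"
| "swap (Dia e f) = Dia e (swap f)"

primrec align :: "var \<Rightarrow> ('p, 'c, 's) fm \<Rightarrow> ('p, 'c, 's) fm" where
  "align z (Atom p ts) = Atom p ts"
| "align z (Equal s t) = Equal s t"
| "align z (Neg f) = Neg (align z f)"
| "align z (Conj f g) = Conj (align z f) (align z g)"
| "align z (Count q n w f) = (if w = z then Count q n (other z) (swap f) else Count q n w f)"
| "align z (Dia e f) = Dia e f"

lemma size_swap_tm [simp]: "size (swap_tm t) = size t"
proof -
  have "size (other z) = size z" for z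
    by (cases z) auto
  then show ?thesis
    by (cases t) auto
qed

lemma size_swap [simp]: "size (swap f) = size f"
  by (induction f) (auto simp: comp_def)

lemma size_align [simp]: "size (align z f) = size f"
  by (induction f) auto

function rename :: "('p, 'c, 's) fm \<Rightarrow> ('p, 'c, 's) fm" where
  "rename (Atom p ts) = Atom p ts"
| "rename (Equal s t) = Equal s t"
| "rename (Neg f) = Neg (rename f)"
| "rename (Conj f g) = Conj (rename f) (rename g)"
| "rename (Count q n z f) = Count q n z (rename f)"
| "rename (Dia e f) = Dia e (rename (align (mf f) f))"
  by pat_completeness auto
termination
  by (relation "measure size") auto

lemma other_other [simp]: "other (other z) = z"
  by (cases z) auto

lemma other_eq_iff: "other z = w \<longleftrightarrow> z = other w"
  by auto

lemma align_id: "z \<notin> outer_bound f \<Longrightarrow> align z f = f"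
  by (induction f) auto

lemma rename_id: "well_named f \<Longrightarrow> rename f = f"
proof (induction f rule: rename.induct)
  case (6 e f)
  have "align (mf f) f = f"
    using 6(2) by (auto simp: well_named_def intro: align_id)
  moreover have "well_named f"
    using 6(2) by (auto simp: well_named_def)
  ultimately show ?case
    using 6(1) by simp
qed (auto simp: well_named_def)

lemma tm_vars_swap [simp]: "tm_vars (swap_tm t) = other ` tm_vars t"
  by (cases t) auto

lemma fv_swap [simp]: "fv (swap f) = other ` fv f"
proof (induction f)
  case (Count q n z f)
  have "inj other" by (metis injI other_other)
  then show ?case using Count by (simp add: image_set_diff)
qed (auto simp: image_Un image_UN)

lemma vars_swap [simp]: "vars (swap f) = other ` vars f"
  by (induction f) (auto simp: image_Un image_UN)

lemma tm_val_swap [simp]: "tm_val I v (swap_tm t) = tm_val I (v \<circ> other) t"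
  by (cases t) auto

lemma upd_other: "v(other z := d) \<circ> other = (v \<circ> other)(z := d)"
  by (auto simp: fun_eq_iff other_eq_iff)

lemma holds_swap: "holds M \<pi> v (swap f) \<longleftrightarrow> holds M \<pi> (v \<circ> other) f"
proof (induction f arbitrary: \<pi> v)
  case (Atom p ts)
  have "map (tm_val (gamma M \<pi>) v) (map swap_tm ts) = map (tm_val (gamma M \<pi>) (v \<circ> other)) ts"
    by simp
  then show ?case by (simp only: swap.simps holds.simps)
qed (simp_all add: upd_other)

lemma tm_val_cong: "(\<And>z. z \<in> tm_vars t \<Longrightarrow> v z = v' z) \<Longrightarrow> tm_val I v t = tm_val I v' t"
  by (cases t) auto

lemma holds_cong: "(\<And>z. z \<in> fv f \<Longrightarrow> v z = v' z) \<Longrightarrow> holds M \<pi> v f \<longleftrightarrow> holds M \<pi> v' f"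
proof (induction f arbitrary: \<pi> v v')
  case (Atom p ts)
  then have "map (tm_val (gamma M \<pi>) v) ts = map (tm_val (gamma M \<pi>) v') ts"
    by (auto intro!: tm_val_cong)
  then show ?case by (simp only: holds.simps)
next
  case (Equal s t)
  then have "tm_val (gamma M \<pi>) v s = tm_val (gamma M \<pi>) v' s"
    "tm_val (gamma M \<pi>) v t = tm_val (gamma M \<pi>) v' t"
    by (auto intro!: tm_val_cong)
  then show ?case by simp
next
  case (Count q n z f)
  then have "holds M \<pi> (v(z := d)) f \<longleftrightarrow> holds M \<pi> (v'(z := d)) f" for d
    by (intro Count.IH) auto
  then show ?case by simp
next
  case (Neg f)
  show ?case using Neg.IH[of v v'] Neg.prems by simp
next
  case (Conj f g)
  show ?case using Conj.IH(1)[of v v'] Conj.IH(2)[of v v'] Conj.prems by simp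
next
  case (Dia e f)
  show ?case using Dia.IH[of v v'] Dia.prems by simp
qed

lemma fv_align: "z \<in> {X, Y} \<Longrightarrow> other z \<notin> fv f \<Longrightarrow> fv (align z f) = fv f"
proof (induction f)
  case (Count q n w f)
  have "other ` fv f - {other z} = fv f - {z}" if "w = z"
  proof -
    have "inj other" by (metis injI other_other)
    then have "other ` fv f - {other z} = other ` (fv f - {z})"
      by (simp add: image_set_diff)
    also have "\<dots> = (\<lambda>u. u) ` (fv f - {z})"
    proof (rule image_cong)
      fix u assume "u \<in> fv f - {z}"
      then have "u \<noteq> X" "u \<noteq> Y" using Count.prems that by auto
      then show "other u = u" by (cases u) auto
    qed simp
    finally show ?thesis by simp
  qed
  then show ?case by simp
qed auto

lemma vars_subset_swap: "vars f \<subseteq> {X, Y} \<Longrightarrow> vars (swap f) \<subseteq> {X, Y}"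
  by force

lemma vars_align: "vars f \<subseteq> {X, Y} \<Longrightarrow> vars (align z f) \<subseteq> {X, Y}"
proof (induction f)
  case (Count q n w f)
  then have "vars (swap f) \<subseteq> {X, Y}" by (intro vars_subset_swap) auto
  then show ?case using Count.prems by (cases z) auto
qed auto

lemma holds_align:
  "z \<in> {X, Y} \<Longrightarrow> other z \<notin> fv f \<Longrightarrow> holds M \<pi> v (align z f) \<longleftrightarrow> holds M \<pi> v f"
proof (induction f)
  case (Count q n w f)
  have "holds M \<pi> (v(other z := d)) (swap f) \<longleftrightarrow> holds M \<pi> (v(z := d)) f" if "w = z" for d
  proof -
    have "other z \<notin> fv f" using Count.prems that by auto
    have "((v \<circ> other)(z := d)) u = (v(z := d)) u" if "u \<in> fv f" for u
      using \<open>other z \<notin> fv f\<close> that Count.prems(1) by (cases u) auto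
    then have "holds M \<pi> ((v \<circ> other)(z := d)) f \<longleftrightarrow> holds M \<pi> (v(z := d)) f"
      by (rule holds_cong)
    then show ?thesis by (simp add: holds_swap upd_other)
  qed
  then show ?case by auto
qed auto

definition monodic :: "('p, 'c, 's) fm \<Rightarrow> bool" where
  "monodic f \<longleftrightarrow> (\<forall>e g. Dia e g \<in> subfms f \<longrightarrow> card (fv g) \<le> 1)"

lemma finite_fv [simp]: "finite (fv f)"
proof (induction f)
  case (Atom p ts)
  have "finite (tm_vars t)" for t :: "'b tm" by (cases t) auto
  then show ?case by simp
next
  case (Equal s t)
  then show ?case by (cases s; cases t) auto
qed auto

lemma monodic_simps [simp]:
  "monodic (Atom p ts)"
  "monodic (Equal s t)"
  "monodic (Neg f) \<longleftrightarrow> monodic f"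
  "monodic (Conj f g) \<longleftrightarrow> monodic f \<and> monodic g"
  "monodic (Count q n z f) \<longleftrightarrow> monodic f"
  "monodic (Dia e f) \<longleftrightarrow> card (fv f) \<le> 1 \<and> monodic f"
  unfolding monodic_def by (simp_all, blast+)

lemma monodic_swap: "monodic f \<Longrightarrow> monodic (swap f)"
proof (induction f)
  case (Dia e f)
  have "inj other" by (metis injI other_other)
  then have "card (other ` fv f) = card (fv f)"
    by (meson card_image inj_on_subset subset_UNIV)
  then show ?case using Dia by simp
qed simp_all

lemma monodic_align: "monodic f \<Longrightarrow> monodic (align z f)"
  by (induction f) (simp_all add: monodic_swap)

lemma fv_vars: "fv f \<subseteq> vars f"
  by (induction f) auto

lemma nf_notin_fv:
  assumes "vars f \<subseteq> {X, Y}" "card (fv f) \<le> 1"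
  shows "mf f \<in> {X, Y}" "other (mf f) \<notin> fv f"
proof -
  show "mf f \<in> {X, Y}" by (simp add: mf_def nf_def)
  have "\<not> {X, Y} \<subseteq> fv f"
    using assms(2) card_mono[of "fv f" "{X, Y}"] by auto
  then show "other (mf f) \<notin> fv f" by (auto simp: mf_def nf_def)
qed

lemma rename_correct:
  assumes "vars f \<subseteq> {X, Y}" "monodic f"
  shows fv_rename: "fv (rename f) = fv f"
    and holds_rename: "holds M \<pi> v (rename f) \<longleftrightarrow> holds M \<pi> v f"
proof -
  have "fv (rename f) = fv f \<and> (\<forall>\<pi> v. holds M \<pi> v (rename f) \<longleftrightarrow> holds M \<pi> v f)"
    using assms
  proof (induction f rule: rename.induct)
    case (6 e f)
    have z: "mf f \<in> {X, Y}" "other (mf f) \<notin> fv f"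
      using 6(2,3) nf_notin_fv[of f] by simp_all
    have "monodic f" using 6(3) by simp
    then show ?case
      using 6(1) 6(2) vars_align[of f] monodic_align[of f] fv_align[OF z] holds_align[OF z, where M = M]
      by simp
  qed simp_all
  then show "fv (rename f) = fv f" "holds M \<pi> v (rename f) \<longleftrightarrow> holds M \<pi> v f" by auto
qed

end

theory Submission
  imports Defs
begin

text \<open>
  The \<open>2 ^ m\<close> levels of a model of the translation are linked by \<open>F\<close> into stacks that traverse all
  levels and have a constant type, the set of the \<open>E i\<close> that hold. Stacks are the domain elements of
  the standpoint structure, levels its precisifications.

  Given a standpoint structure, let the type of an element be the set of free diamonds that it
  satisfies. For every realised type and every diamond that an element of this type satisfies, one
  precisification in which some element of this type satisfies the body is enough. As there are at
  most \<open>2 ^ k\<close> types for \<open>k\<close> diamonds, \<open>2 ^ k * k \<le> 2 ^ m\<close> levels suffice.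

  Conversely, a level witnesses a diamond only for some stack of the right type. All other stacks of
  that type get their witness from copies of the level in which two stacks are exchanged.
\<close>

section \<open>Derived connectives\<close>

lemma fo_holds_FTrue [simp]: "fo_holds I v FTrue"
  by (simp add: FTrue_def)

lemma fo_holds_FConjs [simp]: "fo_holds I v (FConjs fs) \<longleftrightarrow> (\<forall>f\<in>set fs. fo_holds I v f)"
  by (induction fs) (simp_all add: FConjs_def)

lemma fo_holds_FDisjs [simp]: "fo_holds I v (FDisjs fs) \<longleftrightarrow> (\<exists>f\<in>set fs. fo_holds I v f)"
  by (induction fs) (simp_all add: FDisjs_def)

lemma count_ok_Exactly_0 [simp]: "count_ok Exactly 0 D \<longleftrightarrow> D = {}"
  by auto

lemma count_ok_Exactly_1 [simp]: "count_ok Exactly (Suc 0) D \<longleftrightarrow> (\<exists>!d. d \<in> D)"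
proof -
  have "count_ok Exactly (Suc 0) D \<longleftrightarrow> (\<exists>d. D = {d})"
    by (auto simp: card_1_singleton_iff)
  also have "\<dots> \<longleftrightarrow> (\<exists>!d. d \<in> D)" by blast
  finally show ?thesis .
qed

lemma count_ok_AtLeast_1 [simp]: "count_ok AtLeast (Suc 0) D \<longleftrightarrow> D \<noteq> {}"
  by (auto simp: Suc_le_eq card_gt_0_iff)

declare count_ok.simps [simp del]

text \<open>A counting quantifier depends only on the cardinality of its extension, so its truth
  value transfers along the injective copy of a domain onto a level.\<close>

lemma count_ok_image:
  assumes "inj_on h D"
  shows "count_ok q n (h ` D) \<longleftrightarrow> count_ok q n D"
  using assms by (cases q) (auto simp: count_ok.simps card_image finite_image_iff)

section \<open>Levels\<close>

definition same_level :: "nat \<Rightarrow> ('d, 'p xpred, 'c) interp \<Rightarrow> 'd \<Rightarrow> 'd \<Rightarrow> bool" where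
  "same_level m I d e \<longleftrightarrow> (\<forall>j<m. [d] \<in> pint I (L j) \<longleftrightarrow> [e] \<in> pint I (L j))"

definition same_type :: "nat \<Rightarrow> ('d, 'p xpred, 'c) interp \<Rightarrow> 'd \<Rightarrow> 'd \<Rightarrow> bool" where
  "same_type l I d e \<longleftrightarrow> (\<forall>i\<le>l. [d] \<in> pint I (E i) \<longleftrightarrow> [e] \<in> pint I (E i))"

lemma same_level_sym: "same_level m I d e \<longleftrightarrow> same_level m I e d"
  by (auto simp: same_level_def)

lemma same_type_sym: "same_type l I d e \<longleftrightarrow> same_type l I e d"
  by (auto simp: same_type_def)

lemma same_type_refl: "same_type l I d d"
  by (simp add: same_type_def)

lemma same_type_trans: "same_type l I d e \<Longrightarrow> same_type l I e f \<Longrightarrow> same_type l I d f"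
  by (simp add: same_type_def)

lemma fo_holds_eqL [simp]: "fo_holds I w (eqL m) \<longleftrightarrow> same_level m I (w X) (w Y)"
  by (auto simp: eqL_def same_level_def)

lemma fo_holds_eqE [simp]: "fo_holds I w (eqE l) \<longleftrightarrow> same_type l I (w X) (w Y)"
proof -
  have "(i < Suc l) = (i \<le> l)" for i by auto
  then show ?thesis by (auto simp: eqE_def same_type_def simp del: upt_Suc)
qed

text \<open>The number whose binary digits, least significant first, are the truth values of the
  predicates \<open>L j\<close>. It turns the digit-wise stack axioms into arithmetic.\<close>

definition level :: "nat \<Rightarrow> ('d, 'p xpred, 'c) interp \<Rightarrow> 'd \<Rightarrow> nat" where
  "level m I d = horner_sum of_bool 2 (map (\<lambda>j. [d] \<in> pint I (L j)) [0..<m])"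

lemma bit_level: "j < m \<Longrightarrow> bit (level m I d) j \<longleftrightarrow> [d] \<in> pint I (L j)"
  by (simp add: level_def bit_horner_sum_bit_iff)

lemma nat_eq_iff_bits:
  fixes n k :: nat
  assumes "n < 2 ^ m" "k < 2 ^ m"
  shows "n = k \<longleftrightarrow> (\<forall>j<m. bit n j \<longleftrightarrow> bit k j)"
proof
  assume "\<forall>j<m. bit n j \<longleftrightarrow> bit k j"
  then have "take_bit m n = take_bit m k"
    by (intro bit_eqI) (auto simp: bit_take_bit_iff)
  then show "n = k" using assms by (simp add: take_bit_nat_eq_self)
qed simp

lemma level_less: "level m I d < 2 ^ m"
proof -
  have "take_bit m (level m I d) = level m I d"
    by (intro bit_eqI) (auto simp: bit_take_bit_iff level_def bit_horner_sum_bit_iff)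
  then show ?thesis by (metis take_bit_nat_less_exp)
qed

lemma same_level_iff: "same_level m I d e \<longleftrightarrow> level m I d = level m I e"
  by (simp add: same_level_def nat_eq_iff_bits[OF level_less level_less] bit_level)

text \<open>The carry rule: adding one flips a digit exactly if all lower digits are one. This is
  the pattern of (F5).\<close>

lemma bit_Suc_nat_iff:
  "bit (Suc n) j \<longleftrightarrow> (bit n j \<longleftrightarrow> (\<exists>i<j. \<not> bit n i))" for n :: nat
proof (induction j arbitrary: n)
  case 0
  show ?case by (simp add: bit_0)
next
  case (Suc j)
  \<comment> \<open>The lowest digit absorbs the carry if \<open>n\<close> is even; otherwise the
    carry passes on to \<open>n div 2\<close>, to which the induction hypothesis applies.\<close>
  show ?case
  proof (cases "even n")
    case True
    then have "\<exists>i<Suc j. \<not> bit n i" by (auto intro!: exI[of _ 0] simp: bit_0)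
    moreover have "Suc n div 2 = n div 2" using True by (auto elim: evenE)
    ultimately show ?thesis by (simp add: bit_Suc)
  next
    case False
    then have "Suc n div 2 = Suc (n div 2)" by (auto elim: oddE)
    moreover have "(\<exists>i<Suc j. \<not> bit n i) \<longleftrightarrow> (\<exists>i<j. \<not> bit (n div 2) i)"
      using False by (auto simp: less_Suc_eq_0_disj bit_0 bit_Suc)
    ultimately show ?thesis using Suc[of "n div 2"] by (simp add: bit_Suc)
  qed
qed

lemma all_bits_iff: "n < 2 ^ m \<Longrightarrow> (\<forall>j<m. bit n j) \<longleftrightarrow> Suc n = 2 ^ m" for n :: nat
proof -
  assume n: "n < 2 ^ m"
  have "Suc (mask m :: nat) = 2 ^ m" by (simp add: mask_eq_exp_minus_1)
  then show ?thesis using nat_eq_iff_bits[OF n, of "mask m"] by (auto simp: bit_mask_iff)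
qed

lemma no_bits_iff: "n < 2 ^ m \<Longrightarrow> (\<forall>j<m. \<not> bit n j) \<longleftrightarrow> n = 0" for n :: nat
  using nat_eq_iff_bits[of n m 0] by auto

text \<open>This is where digits are traded for arithmetic. The conjunct from (F5) stays digit-wise
  because it describes the increment modulo \<open>2 ^ m\<close>; the wraparound is excluded only by
  combining it with the conjunct from (F2).\<close>

lemma stack_iff:
  assumes "finite (preds S)"
  shows "fo_holds I w (stack S m) \<longleftrightarrow>
    (\<forall>x\<in>idom I. Suc (level m I x) < 2 ^ m \<longrightarrow> (\<exists>!y. y \<in> idom I \<and> [x, y] \<in> pint I F)) \<and>
    (\<forall>x\<in>idom I. Suc (level m I x) = 2 ^ m \<longrightarrow> \<not> (\<exists>y\<in>idom I. [x, y] \<in> pint I F)) \<and>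
    (\<forall>x\<in>idom I. level m I x \<noteq> 0 \<longrightarrow> (\<exists>!y. y \<in> idom I \<and> [y, x] \<in> pint I F)) \<and>
    (\<forall>x\<in>idom I. level m I x = 0 \<longrightarrow> \<not> (\<exists>y\<in>idom I. [y, x] \<in> pint I F)) \<and>
    (\<forall>x\<in>idom I. \<forall>y\<in>idom I. [x, y] \<in> pint I F \<longrightarrow>
       (\<forall>j<m. bit (level m I y) j \<longleftrightarrow> bit (Suc (level m I x)) j)) \<and>
    (\<forall>p\<in>preds S. arity S p = 2 \<longrightarrow>
       (\<forall>x\<in>idom I. \<forall>y\<in>idom I. [x, y] \<in> pint I (Old p) \<longrightarrow> level m I x = level m I y))"
proof -
  have top: "(\<forall>j<m. [x] \<in> pint I (L j)) \<longleftrightarrow> Suc (level m I x) = 2 ^ m" for x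
    using all_bits_iff[OF level_less, of m I x] by (simp add: bit_level)
  have nottop: "(\<exists>j<m. [x] \<notin> pint I (L j)) \<longleftrightarrow> Suc (level m I x) < 2 ^ m" for x
    using top[of x] level_less[of m I x] by (metis Suc_lessI less_irrefl)
  have bot: "(\<forall>j<m. [x] \<notin> pint I (L j)) \<longleftrightarrow> level m I x = 0" for x
    using no_bits_iff[OF level_less, of m I x] by (simp add: bit_level)
  have notbot: "(\<exists>j<m. [x] \<in> pint I (L j)) \<longleftrightarrow> level m I x \<noteq> 0" for x
    using bot[of x] by metis
  \<comment> \<open>Finiteness provides a list for the choice behind
    \<open>binary_preds\<close>.\<close>
  have "\<exists>ps. distinct ps \<and> set ps = {p \<in> preds S. arity S p = 2}"
    using assms finite_distinct_list[of "{p \<in> preds S. arity S p = 2}"] by auto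
  then have bin: "set (binary_preds S) = {p \<in> preds S. arity S p = 2}"
    unfolding binary_preds_def by (rule someI2_ex) simp
  have succ: "(\<forall>j<m. ([x] \<in> pint I (L j) \<longleftrightarrow> [y] \<in> pint I (L j)) \<longleftrightarrow> (\<exists>i<j. [x] \<notin> pint I (L i)))
     \<longleftrightarrow> (\<forall>j<m. bit (level m I y) j \<longleftrightarrow> bit (Suc (level m I x)) j)" for x y
  proof (intro all_cong1 imp_cong refl)
    fix j assume "j < m"
    then have "(\<exists>i<j. [x] \<notin> pint I (L i)) \<longleftrightarrow> (\<exists>i<j. \<not> bit (level m I x) i)"
      by (auto simp: bit_level)
    then show "(([x] \<in> pint I (L j) \<longleftrightarrow> [y] \<in> pint I (L j)) \<longleftrightarrow> (\<exists>i<j. [x] \<notin> pint I (L i)))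
      \<longleftrightarrow> (bit (level m I y) j \<longleftrightarrow> bit (Suc (level m I x)) j)"
      using \<open>j < m\<close> by (auto simp: bit_Suc_nat_iff bit_level)
  qed
  txt \<open>The last of these has the disjunctive shape to which the simplifier reduces (F5).\<close>
  have rules:
    "(\<forall>j\<in>{0..<m}. [x] \<in> pint I (L j)) \<longleftrightarrow> Suc (level m I x) = 2 ^ m"
    "(\<exists>j\<in>{0..<m}. [x] \<notin> pint I (L j)) \<longleftrightarrow> Suc (level m I x) < 2 ^ m"
    "(\<forall>j\<in>{0..<m}. [x] \<notin> pint I (L j)) \<longleftrightarrow> level m I x = 0"
    "(\<exists>j\<in>{0..<m}. [x] \<in> pint I (L j)) \<longleftrightarrow> level m I x \<noteq> 0"
    "0 < level m I x \<or> R \<longleftrightarrow> (level m I x = 0 \<longrightarrow> R)"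
    "level m I x = 0 \<or> R \<longleftrightarrow> (0 < level m I x \<longrightarrow> R)"
    "(\<forall>j\<in>{0..<m}.
       ([x] \<in> pint I (L j) \<and> [y] \<notin> pint I (L j) \<or>
        [y] \<in> pint I (L j) \<and> [x] \<notin> pint I (L j) \<or> (\<exists>i\<in>{0..<j}. [x] \<notin> pint I (L i))) \<and>
       ((\<forall>i\<in>{0..<j}. [x] \<in> pint I (L i)) \<or>
        ([x] \<in> pint I (L j) \<longrightarrow> [y] \<in> pint I (L j)) \<and>
        ([y] \<in> pint I (L j) \<longrightarrow> [x] \<in> pint I (L j))))
     \<longleftrightarrow> (\<forall>j<m. bit (level m I y) j \<longleftrightarrow> bit (Suc (level m I x)) j)" for x y R
    subgoal using top[of x] by (simp add: Ball_def)
    subgoal using nottop[of x] by (simp add: Bex_def)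
    subgoal using bot[of x] by (simp add: Ball_def)
    subgoal using notbot[of x] by (simp add: Bex_def)
    subgoal by auto
    subgoal by auto
    subgoal unfolding succ[symmetric] atLeastLessThan_iff Ball_def Bex_def by blast
    done
  show ?thesis
    unfolding stack_def fo_holds_FConjs
    by (simp add: bin ball_Un same_level_iff rules, intro arg_cong2[where f = "(\<and>)"]; blast)
qed

section \<open>The fragment as a recursive predicate\<close>

text \<open>The recursive form lets structural induction carry the conditions of the fragment.
  \<open>Q\<close> is the condition on bodies of diamonds: \<open>tracks\<close> before renaming,
  and correct naming in addition afterwards. Empty argument lists are excluded because an empty
  tuple does not reveal the level it belongs to.\<close>

primrec frag :: "('p, 'c, 's) sp_sig \<Rightarrow> (('p, 'c, 's) fm \<Rightarrow> bool) \<Rightarrow> ('p, 'c, 's) fm \<Rightarrow> bool" where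
  "frag S Q (Atom p ts) \<longleftrightarrow>
     p \<in> preds S \<and> ts \<noteq> [] \<and> length ts = arity S p \<and> set ts \<subseteq> {Var X, Var Y}"
| "frag S Q (Equal s t) \<longleftrightarrow> {s, t} \<subseteq> {Var X, Var Y}"
| "frag S Q (Neg f) \<longleftrightarrow> frag S Q f"
| "frag S Q (Conj f g) \<longleftrightarrow> frag S Q f \<and> frag S Q g"
| "frag S Q (Count q n z f) \<longleftrightarrow> z \<in> {X, Y} \<and> frag S Q f"
| "frag S Q (Dia e f) \<longleftrightarrow> e = Sym Star \<and> Q f \<and> frag S Q f"

lemma frag_intro:
  assumes "wf_fm S f" "vars f \<subseteq> {X, Y}"
    and "\<forall>p ts. Atom p ts \<in> subfms f \<longrightarrow>
      arity S p \<noteq> 0 \<and> (\<forall>t\<in>set ts. tm_consts t = {})"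
    and "\<forall>s t. Equal s t \<in> subfms f \<longrightarrow> tm_consts s = {} \<and> tm_consts t = {}"
    and "\<forall>e g. Dia e g \<in> subfms f \<longrightarrow> e = Sym Star \<and> Q g"
  shows "frag S Q f"
  using assms
proof (induction f)
  case (Atom p ts)
  have "t \<in> {Var X, Var Y}" if "t \<in> set ts" for t
  proof -
    have "tm_vars t \<subseteq> {X, Y}" "tm_consts t = {}" using Atom.prems(2,3) that by auto
    then show ?thesis by (cases t) auto
  qed
  then show ?case using Atom.prems(1,3) by auto
next
  case (Equal s t)
  then show ?case by (cases s; cases t) auto
next
  case (Dia e f)
  have "e = Sym Star \<and> Q f" using Dia.prems(5) by simp
  moreover have "\<forall>e g. Dia e g \<in> subfms f \<longrightarrow> e = Sym Star \<and> Q g"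
    using Dia.prems(5) unfolding subfms.simps by blast
  then have "frag S Q f" by (rule Dia.IH[rotated -1]) (use Dia.prems(1-4) in simp_all)
  ultimately show ?case by simp
qed auto

lemma frag_vars: "frag S Q f \<Longrightarrow> vars f \<subseteq> {X, Y}"
proof (induction f)
  case (Atom p ts)
  then have "tm_vars t \<subseteq> {X, Y}" if "t \<in> set ts" for t
    using that by auto
  then show ?case by auto
qed auto

lemma frag_outer_bound: "frag S Q f \<Longrightarrow> outer_bound f \<subseteq> {X, Y}"
  by (induction f) auto

lemma frag_monodic: "(\<And>g. Q g \<Longrightarrow> card (fv g) \<le> 1) \<Longrightarrow> frag S Q f \<Longrightarrow> monodic f"
  by (induction f) auto

lemma frag_swap: "(\<And>g. Q g \<Longrightarrow> Q (swap g)) \<Longrightarrow> frag S Q f \<Longrightarrow> frag S Q (swap f)"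
  by (induction f) auto

lemma frag_align: "(\<And>g. Q g \<Longrightarrow> Q (swap g)) \<Longrightarrow> frag S Q f \<Longrightarrow> frag S Q (align z f)"
  by (induction f) (auto simp: frag_swap)

lemma outer_bound_rename: "outer_bound (rename f) = outer_bound f"
  by (induction f rule: rename.induct) auto

lemma outer_bound_align: "z \<in> {X, Y} \<Longrightarrow> z \<notin> outer_bound (align z f)"
  by (induction f) auto

text \<open>Renaming can turn one diamond of the input into several diamonds that differ only in their
  variable, so its output may have more diamonds than the \<open>card D\<close> that the number of levels is
  computed from. Constant assignments make such variants indistinguishable.\<close>

definition tracks ::
  "('d, 'w, 'p, 'c, 's) sp_struct \<Rightarrow> ('p, 'c, 's) fm set \<Rightarrow> ('p, 'c, 's) fm \<Rightarrow> bool" where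
  "tracks M D g \<longleftrightarrow> card (fv g) \<le> 1 \<and>
     (\<exists>g'\<in>D. card (fv g') = card (fv g) \<and>
        (\<forall>\<pi> d. holds M \<pi> (\<lambda>_. d) g \<longleftrightarrow> holds M \<pi> (\<lambda>_. d) g'))"

text \<open>A constant assignment is invariant under exchanging the variables, so the same
  \<open>g'\<close> serves for \<open>swap g\<close>.\<close>

lemma tracks_swap:
  assumes "tracks M D g"
  shows "tracks M D (swap g)"
proof -
  have "inj other" by (metis injI other_other)
  then have "card (other ` fv g) = card (fv g)"
    by (meson card_image inj_on_subset subset_UNIV)
  then show ?thesis using assms by (simp add: tracks_def holds_swap comp_def)
qed

text \<open>In a diamond, \<open>align\<close> frees \<open>mf\<close> from the outer quantifiers of
  the body, and the recursive renaming preserves both the outer bound variables and, through the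
  free variables, the choice of \<open>mf\<close>.\<close>

lemma frag_rename:
  "frag S (tracks M D) f \<Longrightarrow>
    frag S (\<lambda>g. tracks M D g \<and> mf g \<notin> outer_bound g) (rename f)"
proof (induction f rule: rename.induct)
  case (6 e f)
  let ?g = "align (mf f) f"
  have tf: "tracks M D f" and ff: "frag S (tracks M D) f" and e: "e = Sym Star"
    using 6(2) by auto
  have g: "frag S (tracks M D) ?g"
    using ff by (intro frag_align tracks_swap)
  have mon: "monodic h" if "frag S (tracks M D) h" for h
    using that by (rule frag_monodic[rotated]) (simp add: tracks_def)
  have z: "mf f \<in> {X, Y}" "other (mf f) \<notin> fv f"
    using tf nf_notin_fv[OF frag_vars[OF ff]] by (auto simp: tracks_def)
  have fv: "fv (rename ?g) = fv f"
    using fv_rename[OF frag_vars[OF g] mon[OF g]] fv_align[OF z] by simp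
  have "holds M \<pi> v (rename ?g) \<longleftrightarrow> holds M \<pi> v f" for \<pi> v
    by (simp only: holds_rename[OF frag_vars[OF g] mon[OF g]] holds_align[OF z])
  then have "tracks M D (rename ?g)"
    using tf fv by (simp add: tracks_def)
  moreover have "mf (rename ?g) \<notin> outer_bound (rename ?g)"
    using outer_bound_align[OF z(1), of f] fv by (simp add: outer_bound_rename mf_def nf_def)
  ultimately show ?case using 6(1)[OF g] e by simp
qed auto

section \<open>Truth preservation\<close>

text \<open>The level of \<open>I\<close> indexed by \<open>a\<close> is a copy, under \<open>h a\<close>, of the precisification \<open>prec a\<close>.\<close>

locale layered =
  fixes S :: "('p, 'c, 's) sp_sig"
    and M :: "('d, 'w, 'p, 'c, 's) sp_struct"
    and I :: "('e, 'p xpred, 'c) interp"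
    and l m :: nat
    and A :: "'a set"
    and prec :: "'a \<Rightarrow> 'w"
    and h :: "'a \<Rightarrow> 'd \<Rightarrow> 'e"
  assumes inj_h: "a \<in> A \<Longrightarrow> inj_on (h a) (dom M)"
    and idom_h: "idom I = (\<Union>a\<in>A. h a ` dom M)"
    and level_h: "a \<in> A \<Longrightarrow> d \<in> dom M \<Longrightarrow> e \<in> idom I \<Longrightarrow>
      same_level m I e (h a d) \<longleftrightarrow> e \<in> h a ` dom M"
    and pint_h: "a \<in> A \<Longrightarrow> p \<in> preds S \<Longrightarrow> ds \<noteq> [] \<Longrightarrow> length ds = arity S p \<Longrightarrow>
      set ds \<subseteq> dom M \<Longrightarrow> map (h a) ds \<in> pint I (Old p) \<longleftrightarrow> ds \<in> pint (gamma M (prec a)) p"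
begin

text \<open>A translated quantifier over \<open>z\<close> reads the level that it ranges over from
  \<open>w (other z)\<close>. So this value has to lie in the level of \<open>a\<close> for the
  outermost quantifiers, although the variable may not be free. Nothing more is required of
  variables that are not free, since right after a diamond \<open>nf\<close> still refers to the old
  level.\<close>

definition adequate :: "('p, 'c, 's) fm \<Rightarrow> bool" where
  "adequate f \<longleftrightarrow> (\<forall>a\<in>A. \<forall>v w.
     (\<forall>z\<in>fv f. v z \<in> dom M \<and> w z = h a (v z)) \<longrightarrow>
     (\<forall>z\<in>outer_bound f. w (other z) \<in> h a ` dom M) \<longrightarrow>
     w X \<in> idom I \<longrightarrow> w Y \<in> idom I \<longrightarrow>
     (holds M (prec a) v f \<longleftrightarrow> fo_holds I w (tr l m f)))"

lemma adequateD:
  assumes "adequate f" "a \<in> A" "\<And>z. z \<in> fv f \<Longrightarrow> v z \<in> dom M \<and> w z = h a (v z)"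
    "\<And>z. z \<in> outer_bound f \<Longrightarrow> w (other z) \<in> h a ` dom M" "w X \<in> idom I" "w Y \<in> idom I"
  shows "holds M (prec a) v f \<longleftrightarrow> fo_holds I w (tr l m f)"
  using assms unfolding adequate_def by blast

lemma h_in_idom: "a \<in> A \<Longrightarrow> d \<in> dom M \<Longrightarrow> h a d \<in> idom I"
  using idom_h by blast

lemma adequate_Count:
  assumes "adequate f" "z \<in> {X, Y}" "outer_bound f \<subseteq> {X, Y}"
  shows "adequate (Count q n z f)"
  unfolding adequate_def
proof (intro ballI allI impI)
  fix a v w
  assume a: "a \<in> A" and fr: "\<forall>u\<in>fv (Count q n z f). v u \<in> dom M \<and> w u = h a (v u)"
    and ob: "\<forall>u\<in>outer_bound (Count q n z f). w (other u) \<in> h a ` dom M"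
    and w: "w X \<in> idom I" "w Y \<in> idom I"
  have oz: "w (other z) \<in> h a ` dom M" using ob by simp
  have lev: "same_level m I ((w(z := e)) X) ((w(z := e)) Y) \<longleftrightarrow> e \<in> h a ` dom M"
    if "e \<in> idom I" for e
  proof -
    obtain d where d: "d \<in> dom M" "w (other z) = h a d" using oz by auto
    have "same_level m I ((w(z := e)) X) ((w(z := e)) Y) \<longleftrightarrow> same_level m I e (w (other z))"
      using assms(2) same_level_sym[of m I "w X" e] by auto
    then show ?thesis using level_h[OF a d(1) that] d(2) by simp
  qed
  \<comment> \<open>An outer quantifier of \<open>f\<close> reads its level either from the new
    element or from \<open>w (other z)\<close>. Both lie in the level of \<open>a\<close>.\<close>
  have tr: "holds M (prec a) (v(z := d)) f \<longleftrightarrow> fo_holds I (w(z := h a d)) (tr l m f)"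
    if "d \<in> dom M" for d
  proof (rule adequateD[OF assms(1) a])
    show "(w(z := h a d)) (other u) \<in> h a ` dom M" if "u \<in> outer_bound f" for u
      using assms(2,3) that oz \<open>d \<in> dom M\<close> by auto
  qed (use fr w that h_in_idom[OF a] in auto)
  have "fo_holds I (w(z := e)) (FConj (eqL m) (tr l m f)) \<longleftrightarrow>
      e \<in> h a ` dom M \<and> fo_holds I (w(z := e)) (tr l m f)" if "e \<in> idom I" for e
    by (simp only: fo_holds.simps fo_holds_eqL lev[OF that])
  then have "{e \<in> idom I. fo_holds I (w(z := e)) (FConj (eqL m) (tr l m f))}
      = {e \<in> h a ` dom M. fo_holds I (w(z := e)) (tr l m f)}"
    using h_in_idom[OF a] by blast
  also have "\<dots> = h a ` {d \<in> dom M. fo_holds I (w(z := h a d)) (tr l m f)}"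
    by blast
  also have "\<dots> = h a ` {d \<in> dom M. holds M (prec a) (v(z := d)) f}"
    using tr by (simp cong: conj_cong)
  finally have "{e \<in> idom I. fo_holds I (w(z := e)) (FConj (eqL m) (tr l m f))}
      = h a ` {d \<in> dom M. holds M (prec a) (v(z := d)) f}" .
  moreover have "inj_on (h a) {d \<in> dom M. holds M (prec a) (v(z := d)) f}"
    using inj_h[OF a] by (rule inj_on_subset) auto
  ultimately show "holds M (prec a) v (Count q n z f) \<longleftrightarrow>
      fo_holds I w (tr l m (Count q n z f))"
    by (simp only: tr.simps fo_holds.simps holds.simps count_ok_image)
qed

text \<open>Only diamonds depend on how \<open>M\<close> and \<open>I\<close> are obtained from one
  another, so their case is left as a hypothesis. Atoms are preserved by \<open>pint_h\<close>,
  equality by injectivity.\<close>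

lemma adequate_frag:
  assumes "frag S Q f" "\<And>g. Q g \<Longrightarrow> frag S Q g \<Longrightarrow> adequate g \<Longrightarrow> adequate (Dia (Sym Star) g)"
  shows "adequate f"
  using assms(1)
proof (induction f)
  case (Atom p ts)
  show ?case
    unfolding adequate_def
  proof (intro ballI allI impI)
    fix a v w
    assume a: "a \<in> A" and fr: "\<forall>z\<in>fv (Atom p ts). v z \<in> dom M \<and> w z = h a (v z)"
    let ?ds = "map (tm_val (gamma M (prec a)) v) ts"
    have val: "tm_val (gamma M (prec a)) v t \<in> dom M \<and>
        tm_val I w t = h a (tm_val (gamma M (prec a)) v t)" if "t \<in> set ts" for t
    proof -
      have "t \<in> {Var X, Var Y}" using Atom that by auto
      moreover have "tm_vars t \<subseteq> fv (Atom p ts)" using that by auto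
      ultimately show ?thesis using fr by auto
    qed
    have "map (tm_val I w) ts = map (h a) ?ds" using val by auto
    moreover have "map (h a) ?ds \<in> pint I (Old p) \<longleftrightarrow> ?ds \<in> pint (gamma M (prec a)) p"
      using Atom val by (intro pint_h a) auto
    ultimately show "holds M (prec a) v (Atom p ts) \<longleftrightarrow> fo_holds I w (tr l m (Atom p ts))"
      by (simp only: holds.simps tr.simps fo_holds.simps)
  qed
next
  case (Equal s t)
  then show ?case
    by (auto simp: adequate_def dest: inj_onD[OF inj_h])
next
  case (Count q n z f)
  then show ?case using frag_outer_bound[of S Q f] by (intro adequate_Count) auto
next
  case (Conj f g)
  then have "adequate f" "adequate g" by simp_all
  show ?case
    unfolding adequate_def
  proof (intro ballI allI impI)
    fix a v w
    assume asm: "a \<in> A" "\<forall>z\<in>fv (Conj f g). v z \<in> dom M \<and> w z = h a (v z)"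
      "\<forall>z\<in>outer_bound (Conj f g). w (other z) \<in> h a ` dom M" "w X \<in> idom I" "w Y \<in> idom I"
    have "holds M (prec a) v f \<longleftrightarrow> fo_holds I w (tr l m f)"
      by (rule adequateD[OF \<open>adequate f\<close> asm(1)]) (use asm in auto)
    moreover have "holds M (prec a) v g \<longleftrightarrow> fo_holds I w (tr l m g)"
      by (rule adequateD[OF \<open>adequate g\<close> asm(1)]) (use asm in auto)
    ultimately show "holds M (prec a) v (Conj f g) \<longleftrightarrow> fo_holds I w (tr l m (Conj f g))"
      by simp
  qed
next
  case (Dia e f)
  then show ?case using assms(2) by simp
qed (simp_all add: adequate_def)

text \<open>The universal quantifier with the guard \<open>x = y\<close> merely copies the value of
  \<open>mf\<close> to \<open>nf\<close>. The existential quantifier can then reassign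
  \<open>mf\<close> while \<open>eqE\<close> compares the new value with the old one.\<close>

lemma tr_Dia_iff:
  assumes "w X \<in> idom I" "w Y \<in> idom I"
  shows "fo_holds I w (tr l m (Dia e g)) \<longleftrightarrow> (\<exists>d\<in>idom I. same_type l I d (w (mf g)) \<and>
    fo_holds I (w(nf g := w (mf g), mf g := d)) (tr l m g))"
proof -
  have "nf g = X \<and> mf g = Y \<or> nf g = Y \<and> mf g = X"
    by (auto simp: mf_def nf_def)
  then show ?thesis
    using assms same_type_sym[of l I] by (elim disjE) (auto simp: fun_upd_twist)
qed

text \<open>Here the naming of bound variables matters. At most \<open>mf\<close> is free, and all
  outer quantifiers bind \<open>nf\<close>, so they read their level from \<open>mf\<close>, that
  is, from \<open>h b d\<close>. Hence \<open>nf\<close> may have any value \<open>e\<close>, even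
  one from another level.\<close>

lemma adequate_const:
  assumes "adequate g" "frag S Q g" "card (fv g) \<le> 1" "mf g \<notin> outer_bound g"
    and "b \<in> A" "d \<in> dom M" "e \<in> idom I"
  shows "fo_holds I (w(nf g := e, mf g := h b d)) (tr l m g) \<longleftrightarrow> holds M (prec b) (\<lambda>_. d) g"
proof -
  have n: "nf g = X \<and> mf g = Y \<or> nf g = Y \<and> mf g = X"
    by (auto simp: mf_def nf_def)
  have fv: "fv g \<subseteq> {mf g}"
    using nf_notin_fv[OF frag_vars[OF assms(2)] assms(3)] fv_vars[of g] frag_vars[OF assms(2)]
    by auto
  have "outer_bound g \<subseteq> {nf g}"
    using frag_outer_bound[OF assms(2)] assms(4) n by auto
  then show ?thesis
    using fv n assms(5-7) h_in_idom[OF assms(5,6)]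
    by (intro adequateD[OF assms(1,5), symmetric]) auto
qed

text \<open>By \<open>tr_Dia_iff\<close> and \<open>adequate_const\<close>, the translated diamond
  asks for an index and an element of the right type that satisfies the body there. This leaves
  \<open>crit\<close>, in which the translation no longer occurs.\<close>

lemma adequate_Dia:
  assumes "adequate g" "frag S Q g" "card (fv g) \<le> 1" "mf g \<notin> outer_bound g"
    and "sigma M Star = precs M"
    and crit: "\<And>a d. a \<in> A \<Longrightarrow> d \<in> dom M \<Longrightarrow>
      (\<exists>\<pi>\<in>precs M. holds M \<pi> (\<lambda>_. d) g) \<longleftrightarrow>
      (\<exists>b\<in>A. \<exists>d'\<in>dom M. same_type l I (h b d') (h a d) \<and> holds M (prec b) (\<lambda>_. d') g)"
  shows "adequate (Dia (Sym Star) g)"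
  unfolding adequate_def
proof (intro ballI allI impI)
  fix a v w
  assume a: "a \<in> A" and fr: "\<forall>u\<in>fv (Dia (Sym Star) g). v u \<in> dom M \<and> w u = h a (v u)"
    and w: "w X \<in> idom I" "w Y \<in> idom I"
  have "mf g \<in> {X, Y}" by (auto simp: mf_def nf_def)
  then have wm: "w (mf g) \<in> idom I" using w by auto
  have fv: "fv g \<subseteq> {mf g}"
    using nf_notin_fv[OF frag_vars[OF assms(2)] assms(3)] fv_vars[of g] frag_vars[OF assms(2)]
    by auto
  \<comment> \<open>The value of \<open>mf\<close> must be presented as a copy of a domain element.
    If \<open>mf\<close> is free, this is the copy in the level of \<open>a\<close>; for a closed
    body it may lie in another level.\<close>
  obtain b d where bd: "b \<in> A" "d \<in> dom M" "w (mf g) = h b d" "mf g \<in> fv g \<Longrightarrow> v (mf g) = d"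
  proof (cases "mf g \<in> fv g")
    case True
    then show ?thesis using that[of a "v (mf g)"] a fr by auto
  next
    case False
    then show ?thesis using that wm idom_h by auto
  qed
  have "holds M \<pi> v g \<longleftrightarrow> holds M \<pi> (\<lambda>_. d) g" for \<pi>
    using fv bd(4) by (intro holds_cong) auto
  then have "holds M (prec a) v (Dia (Sym Star) g) \<longleftrightarrow> (\<exists>\<pi>\<in>precs M. holds M \<pi> (\<lambda>_. d) g)"
    using assms(5) by simp
  also have "\<dots> \<longleftrightarrow>
      (\<exists>b'\<in>A. \<exists>d'\<in>dom M. same_type l I (h b' d') (h b d) \<and> holds M (prec b') (\<lambda>_. d') g)"
    by (rule crit[OF bd(1,2)])
  also have "\<dots> \<longleftrightarrow> (\<exists>b'\<in>A. \<exists>d'\<in>dom M. same_type l I (h b' d') (w (mf g)) \<and>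
      fo_holds I (w(nf g := w (mf g), mf g := h b' d')) (tr l m g))"
    using adequate_const[OF assms(1-4) _ _ wm] bd(3) by (simp cong: bex_cong)
  also have "\<dots> \<longleftrightarrow> fo_holds I w (tr l m (Dia (Sym Star) g))"
    unfolding tr_Dia_iff[where e = "Sym Star", OF w] idom_h by blast
  finally show "holds M (prec a) v (Dia (Sym Star) g) \<longleftrightarrow>
    fo_holds I w (tr l m (Dia (Sym Star) g))" .
qed

text \<open>Both variables denote the same element, whose level selects a precisification. The
  levels cover \<open>idom I\<close> and none is empty, so the element ranges over all
  indices.\<close>

lemma Trans_iff:
  assumes "adequate f" "fv f = {}" "outer_bound f \<subseteq> {X, Y}" "dom M \<noteq> {}"
  shows "fo_holds I w (Trans l m f) \<longleftrightarrow> (\<forall>a\<in>A. holds M (prec a) v f)"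
proof -
  have eq: "holds M (prec a) v f \<longleftrightarrow> fo_holds I (w(X := h a d, Y := h a d)) (tr l m f)"
    if "a \<in> A" "d \<in> dom M" for a d
    using assms(2,3) that h_in_idom[OF that] by (intro adequateD[OF assms(1) that(1)]) auto
  have "fo_holds I w (Trans l m f) \<longleftrightarrow>
      (\<forall>e\<in>idom I. fo_holds I (w(X := e, Y := e)) (tr l m f))"
    by (auto simp: Trans_def)
  also have "\<dots> \<longleftrightarrow> (\<forall>a\<in>A. \<forall>d\<in>dom M. fo_holds I (w(X := h a d, Y := h a d)) (tr l m f))"
    unfolding idom_h by auto
  also have "\<dots> \<longleftrightarrow> (\<forall>a\<in>A. holds M (prec a) v f)"
    using eq assms(4) by blast
  finally show ?thesis .
qed

end


text \<open>The inner premise of \<open>crit\<close> comes from \<open>adequate_const\<close>. It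
  allows truth of \<open>g\<close> in two precisifications to be compared through a common element
  of \<open>I\<close>.\<close>

lemma adequate_rename:
  assumes "layered S M I m A prec h" "sigma M Star = precs M"
    and "frag S (tracks M D) f"
    and crit: "\<And>g a d. tracks M D g \<Longrightarrow>
      (\<And>b d' e w. b \<in> A \<Longrightarrow> d' \<in> dom M \<Longrightarrow> e \<in> idom I \<Longrightarrow>
        fo_holds I (w(nf g := e, mf g := h b d')) (tr l m g) \<longleftrightarrow> holds M (prec b) (\<lambda>_. d') g) \<Longrightarrow>
      a \<in> A \<Longrightarrow> d \<in> dom M \<Longrightarrow>
      (\<exists>\<pi>\<in>precs M. holds M \<pi> (\<lambda>_. d) g) \<longleftrightarrow>
      (\<exists>b\<in>A. \<exists>d'\<in>dom M. same_type l I (h b d') (h a d) \<and> holds M (prec b) (\<lambda>_. d') g)"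
  shows "layered.adequate M I l m A prec h (rename f)"
proof -
  interpret layered S M I l m A prec h by (rule assms(1))
  show ?thesis
  proof (rule adequate_frag[OF frag_rename[OF assms(3)]])
    fix g
    assume t: "tracks M D g \<and> mf g \<notin> outer_bound g" and ad: "adequate g"
      and fr: "frag S (\<lambda>g. tracks M D g \<and> mf g \<notin> outer_bound g) g"
    have c: "card (fv g) \<le> 1" using t by (simp add: tracks_def)
    show "adequate (Dia (Sym Star) g)"
      using t by (intro adequate_Dia[OF ad fr c _ assms(2)] crit adequate_const[OF ad fr c]) auto
  qed
qed

lemma frag_tracks:
  assumes "wf_fm S f" "frugal_monodic_C2 S f"
  shows "frag S (tracks M {g. Dia (Sym Star) g \<in> subfms f}) f"
proof (rule frag_intro[OF assms(1)])
  show "\<forall>p ts. Atom p ts \<in> subfms f \<longrightarrow> arity S p \<noteq> 0 \<and> (\<forall>t\<in>set ts. tm_consts t = {})"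
    using assms(2) by (fastforce simp: frugal_monodic_C2_def)
qed (use assms(2) in \<open>auto simp: frugal_monodic_C2_def tracks_def\<close>)

section \<open>From precisifications to levels\<close>

text \<open>An infinite cardinal equals its square. Such codings keep the constructed models within
  the given type \<open>'u\<close>.\<close>

lemma infinite_pair_inj:
  assumes "infinite (UNIV :: 'u set)"
  shows "\<exists>c :: 'u \<times> 'u \<Rightarrow> 'u. inj c"
proof -
  have "\<exists>c :: 'u \<times> 'u \<Rightarrow> 'u. bij_betw c (UNIV \<times> UNIV) UNIV"
    using card_of_Times_same_infinite[OF assms] card_of_ordIso by blast
  then show ?thesis by (auto simp: bij_betw_def)
qed

lemma infinite_nat_pair_inj:
  assumes "infinite (UNIV :: 'u set)"
  shows "\<exists>c :: nat \<times> 'u \<Rightarrow> 'u. inj c"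
proof -
  obtain g :: "'u \<times> 'u \<Rightarrow> 'u" where g: "inj g" using infinite_pair_inj[OF assms] by blast
  obtain f :: "nat \<Rightarrow> 'u" where f: "inj f" using infinite_countable_subset[OF assms] by blast
  have "inj (\<lambda>(n, u). g (f n, u))"
    by (auto simp: inj_def inj_eq[OF f] inj_eq[OF g])
  then show ?thesis by blast
qed

lemma finite_subfms: "finite (subfms f)"
  by (induction f) auto

lemma Dia_set_eq: "Dia_set f = Dia (Sym Star) ` {g. Dia (Sym Star) g \<in> subfms f}"
  by (auto simp: Dia_set_def)

lemma finite_Dia_set: "finite (Dia_set f)"
  by (simp add: Dia_set_def finite_subfms)

text \<open>The product of the number of potential types and the number of diamonds is
  \<open>2 powr (k + log 2 k)\<close>, and rounding the exponent up only enlarges it.\<close>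

lemma num_bits_bound:
  assumes "card (Dia_set f) \<noteq> 0"
  shows "2 ^ card (Dia_set f) * card (Dia_set f) \<le> 2 ^ num_bits f"
proof -
  let ?k = "card (Dia_set f)"
  have m: "num_bits f = nat \<lceil>real ?k + log 2 (real ?k)\<rceil>"
    using assms by (simp add: num_bits_def Let_def)
  have "real (2 ^ ?k * ?k) = 2 powr real ?k * 2 powr log 2 (real ?k)"
    using assms by (simp add: powr_realpow)
  also have "\<dots> = 2 powr (real ?k + log 2 (real ?k))"
    by (simp add: powr_add)
  also have "\<dots> \<le> 2 powr real (num_bits f)"
    unfolding m by (rule powr_mono) linarith+
  also have "\<dots> = real (2 ^ num_bits f)"
    by (simp add: powr_realpow)
  finally show ?thesis by (simp only: of_nat_le_iff)
qed

lemma ex_enumeration: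
  assumes "finite W" "W \<noteq> {}" "card W \<le> N"
  shows "\<exists>p :: nat \<Rightarrow> 'w. range p \<subseteq> W \<and> W \<subseteq> p ` {..<N}"
proof -
  obtain f where f: "bij_betw f {0..<card W} W"
    using ex_bij_betw_nat_finite[OF assms(1)] by blast
  have W: "f ` {0..<card W} = W" using f by (simp add: bij_betw_def)
  have pos: "0 < card W" using assms by (simp add: card_gt_0_iff)
  \<comment> \<open>Surplus indices repeat an element of \<open>W\<close>, so that every level is a
    copy of an actual precisification.\<close>
  let ?p = "\<lambda>i. if i < card W then f i else f 0"
  have "range ?p \<subseteq> W" using W pos by auto
  moreover have "W \<subseteq> ?p ` {..<N}"
  proof
    fix x assume "x \<in> W"
    then have "x \<in> f ` {0..<card W}" using W by simp
    then obtain i where "i < card W" "x = f i" by auto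
    then show "x \<in> ?p ` {..<N}" using assms(3) by (intro image_eqI[of _ _ i]) auto
  qed
  ultimately show ?thesis by blast
qed

lemma ex_witnesses:
  fixes M :: "('d, 'w, 'p, 'c, 's) sp_struct" and f :: "('p, 'c, 's) fm" and \<pi>0 :: 'w
  assumes "precs M \<noteq> {}" "dom M \<noteq> {}"
  defines "tp \<equiv> \<lambda>d. {D \<in> FreeDia_set f. holds M \<pi>0 (\<lambda>_. d) D}"
  shows "\<exists>p :: nat \<Rightarrow> 'w. range p \<subseteq> precs M \<and> (\<forall>g d \<pi>. Dia (Sym Star) g \<in> subfms f \<longrightarrow> d \<in> dom M \<longrightarrow>
    \<pi> \<in> precs M \<longrightarrow> holds M \<pi> (\<lambda>_. d) g \<longrightarrow>
    (\<exists>i<2 ^ num_bits f. \<exists>d'\<in>dom M. tp d' = tp d \<and> holds M (p i) (\<lambda>_. d') g))"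
proof (cases "Dia_set f = {}")
  case True
  \<comment> \<open>Without diamonds nothing needs a witness, and any precisification can fill the
    levels.\<close>
  obtain \<pi> where "\<pi> \<in> precs M" using assms(1) by auto
  then have "range (\<lambda>_ :: nat. \<pi>) \<subseteq> precs M" by auto
  moreover have "Dia (Sym Star) g \<notin> subfms f" for g using True by (auto simp: Dia_set_def)
  ultimately show ?thesis by blast
next
  case False
  let ?G = "{g. Dia (Sym Star) g \<in> subfms f}"
  let ?Z = "tp ` dom M \<times> ?G"
  define ok where "ok = (\<lambda>(T, g) \<pi>. \<exists>d\<in>dom M. tp d = T \<and> holds M \<pi> (\<lambda>_. d) g)"
  have inj: "inj_on (Dia (Sym Star)) ?G" by (auto simp: inj_on_def)
  have cG: "card ?G = card (Dia_set f)" "finite ?G"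
    using finite_Dia_set[of f] inj by (simp_all add: Dia_set_eq card_image finite_image_iff)
  have sub: "tp ` dom M \<subseteq> Pow (FreeDia_set f)" by (auto simp: tp_def)
  have fF: "finite (FreeDia_set f)" by (simp add: FreeDia_set_def finite_Dia_set)
  have fin: "finite (tp ` dom M)" using sub fF by (simp add: finite_subset)
  have "card (tp ` dom M) \<le> 2 ^ card (FreeDia_set f)"
    using card_mono[OF _ sub] fF by (simp add: card_Pow)
  also have "\<dots> \<le> 2 ^ card (Dia_set f)"
    using card_mono[OF finite_Dia_set, of "FreeDia_set f" f] by (simp add: FreeDia_set_def)
  finally have "card ?Z \<le> 2 ^ card (Dia_set f) * card (Dia_set f)"
    by (simp add: card_cartesian_product cG)
  also have "\<dots> \<le> 2 ^ num_bits f"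
    using False finite_Dia_set by (intro num_bits_bound) (simp add: card_gt_0_iff)
  finally have cZ: "card ?Z \<le> 2 ^ num_bits f" .
  \<comment> \<open>A pair of a type and a body without a witness receives an arbitrary
    precisification, which makes \<open>wit\<close> total.\<close>
  have "\<exists>\<pi>. \<pi> \<in> precs M \<and> ((\<exists>\<pi>'\<in>precs M. ok z \<pi>') \<longrightarrow> ok z \<pi>)" for z
    using assms(1) by (cases "\<exists>\<pi>'\<in>precs M. ok z \<pi>'") auto
  then have "\<exists>wit. \<forall>z. wit z \<in> precs M \<and> ((\<exists>\<pi>'\<in>precs M. ok z \<pi>') \<longrightarrow> ok z (wit z))"
    by (intro choice allI)
  then obtain wit where wit: "\<And>z. wit z \<in> precs M"
      "\<And>z \<pi>. \<pi> \<in> precs M \<Longrightarrow> ok z \<pi> \<Longrightarrow> ok z (wit z)"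
    by auto
  have fZ: "finite ?Z" using fin cG by simp
  have Zne: "?Z \<noteq> {}" using assms(2) False by (auto simp: Dia_set_eq)
  have "card (wit ` ?Z) \<le> 2 ^ num_bits f"
    using card_image_le[OF fZ, of wit] cZ by linarith
  then have "\<exists>p :: nat \<Rightarrow> 'w. range p \<subseteq> wit ` ?Z \<and> wit ` ?Z \<subseteq> p ` {..<2 ^ num_bits f}"
    using finite_imageI[OF fZ, of wit] Zne by (intro ex_enumeration) simp_all
  then obtain p :: "nat \<Rightarrow> 'w"
    where p: "range p \<subseteq> wit ` ?Z" "wit ` ?Z \<subseteq> p ` {..<2 ^ num_bits f}"
    by (elim exE conjE)
  have "wit ` ?Z \<subseteq> precs M" by (intro image_subsetI wit(1))
  with p(1) have rp: "range p \<subseteq> precs M" by (rule subset_trans)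
  have ex: "\<exists>i<2 ^ num_bits f. \<exists>d'\<in>dom M. tp d' = tp d \<and> holds M (p i) (\<lambda>_. d') g"
    if "Dia (Sym Star) g \<in> subfms f" "d \<in> dom M" "\<pi> \<in> precs M" "holds M \<pi> (\<lambda>_. d) g" for g d \<pi>
  proof -
    have z: "(tp d, g) \<in> ?Z" using that by auto
    have "ok (tp d, g) \<pi>" using that unfolding ok_def by blast
    then have "ok (tp d, g) (wit (tp d, g))" by (rule wit(2)[OF that(3)])
    then have "\<exists>d'\<in>dom M. tp d' = tp d \<and> holds M (wit (tp d, g)) (\<lambda>_. d') g"
      by (simp add: ok_def)
    moreover obtain i where i: "i < 2 ^ num_bits f" "wit (tp d, g) = p i"
      using subsetD[OF p(2) imageI[OF z]] by auto
    ultimately show ?thesis using i(1) by (intro exI[of _ i]) simp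
  qed
  show ?thesis by (intro exI[of _ p] conjI rp allI impI) (rule ex)
qed

lemma fo_satisfiable_if_sp_satisfiable:
  fixes f :: "('p, 'c, 's) fm" and S :: "('p, 'c, 's) sp_sig"
  assumes "infinite (UNIV :: 'u set)" "finite (preds S)" "cnsts S = {}"
    and "wf_fm S f" "frugal_monodic_C2 S f" "fv f = {}"
    and "sp_satisfiable TYPE('u) S f"
  defines "l \<equiv> card (FreeDia_set f)" and "m \<equiv> num_bits f"
  shows "fo_satisfiable TYPE('u) (xsig l m S)
    (FConj (FConj (stack S m) (rigE l)) (Trans l m (rename f)))"
proof -
  obtain M :: "('u, 'u, 'p, 'c, 's) sp_struct" where M: "wf_struct S M" "sp_models M f"
    using assms(7) by (auto simp: sp_satisfiable_def)
  have ne: "dom M \<noteq> {}" "precs M \<noteq> {}" and star: "sigma M Star = precs M"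
    using M(1) by (auto simp: wf_struct_def)
  have pint_dom: "set us \<subseteq> dom M \<and> length us = arity S p"
    if "us \<in> pint (gamma M \<pi>) p" "\<pi> \<in> precs M" "p \<in> preds S" for us p \<pi>
    using M(1) that unfolding wf_struct_def wf_interp_def by blast
  obtain \<pi>0 where \<pi>0: "\<pi>0 \<in> precs M" using ne by auto
  \<comment> \<open>Diamonds over \<open>Star\<close> have the same truth value in every
    precisification, so evaluating types at \<open>\<pi>0\<close> is no restriction.\<close>
  define tp where "tp = (\<lambda>d. {D \<in> FreeDia_set f. holds M \<pi>0 (\<lambda>_. d) D})"
  obtain pr :: "nat \<Rightarrow> 'u" where pr: "range pr \<subseteq> precs M"
    and wit: "\<forall>g d \<pi>. Dia (Sym Star) g \<in> subfms f \<longrightarrow> d \<in> dom M \<longrightarrow> \<pi> \<in> precs M \<longrightarrow>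
      holds M \<pi> (\<lambda>_. d) g \<longrightarrow>
      (\<exists>i<2 ^ m. \<exists>d'\<in>dom M. tp d' = tp d \<and> holds M (pr i) (\<lambda>_. d') g)"
    using ex_witnesses[OF ne(2,1), of f \<pi>0] unfolding tp_def m_def by (elim exE conjE)
  obtain c :: "nat \<times> 'u \<Rightarrow> 'u" where "inj c"
    using infinite_nat_pair_inj[OF assms(1)] by blast
  then have c [simp]: "c x = c y \<longleftrightarrow> x = y" for x y by (rule inj_eq)
  have "finite (FreeDia_set f)" by (simp add: FreeDia_set_def finite_Dia_set)
  then obtain ds where ds: "set ds = FreeDia_set f" "length ds = l"
    using finite_distinct_list distinct_card unfolding l_def by metis
  \<comment> \<open>Elements are coded pairs of a level and a domain element, and \<open>F\<close>
    climbs one level while keeping the domain element. \<open>E j\<close> is evaluated at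
    \<open>\<pi>0\<close> and hence constant along stacks. There is one more \<open>E\<close>
    predicate than there are free diamonds; \<open>E l\<close> is empty.\<close>
  define J :: "('u, 'p xpred, 'c) interp" where "J =
    \<lparr>idom = c ` ({..<2 ^ m} \<times> dom M),
     pint = (\<lambda>q. case q of
         Old p \<Rightarrow> {map (\<lambda>d. c (i, d)) us | i us. i < 2 ^ m \<and> us \<in> pint (gamma M (pr i)) p}
       | E j \<Rightarrow> {[c (i, d)] | i d. i < 2 ^ m \<and> d \<in> dom M \<and> j < l \<and> holds M \<pi>0 (\<lambda>_. d) (ds ! j)}
       | L j \<Rightarrow> {[c (i, d)] | i d. i < 2 ^ m \<and> d \<in> dom M \<and> bit i j}
       | F \<Rightarrow> {[c (i, d), c (Suc i, d)] | i d. Suc i < 2 ^ m \<and> d \<in> dom M}),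
     cint = undefined\<rparr>"
  have idom: "idom J = c ` ({..<2 ^ m} \<times> dom M)"
    and OldJ: "pint J (Old p) =
      {map (\<lambda>d. c (i, d)) us | i us. i < 2 ^ m \<and> us \<in> pint (gamma M (pr i)) p}"
    and EJ: "[c (i, d)] \<in> pint J (E j) \<longleftrightarrow>
      i < 2 ^ m \<and> d \<in> dom M \<and> j < l \<and> holds M \<pi>0 (\<lambda>_. d) (ds ! j)"
    and LJ: "[c (i, d)] \<in> pint J (L j) \<longleftrightarrow> i < 2 ^ m \<and> d \<in> dom M \<and> bit i j"
    and FJ: "[c (i, d), c (i', d')] \<in> pint J F \<longleftrightarrow> i' = Suc i \<and> d' = d \<and> i' < 2 ^ m \<and> d \<in> dom M"
    for p i d i' d' j
    by (auto simp: J_def)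
  have wfJ: "wf_interp (xsig l m S) J"
    unfolding wf_interp_def
  proof (intro conjI ballI)
    have "c (0, SOME d. d \<in> dom M) \<in> idom J"
      using ne(1) unfolding idom by (intro imageI) (auto simp: some_in_eq)
    then show "idom J \<noteq> {}" by blast
  next
    fix q assume q: "q \<in> preds (xsig l m S)"
    show "pint J q \<subseteq> {us. set us \<subseteq> idom J \<and> length us = arity (xsig l m S) q}"
    proof (cases q)
      case (Old p)
      have "p \<in> preds S" using q Old by (auto simp: xsig_def)
      then show ?thesis using pint_dom pr by (fastforce simp: Old OldJ idom xsig_def)
    qed (auto simp: J_def xsig_def)
  next
    fix k assume "k \<in> cnsts (xsig l m S)"
    then show "cint J k \<in> idom J" using assms(3) by (simp add: xsig_def)
  qed
  have lev: "level m J (c (i, d)) = i" if "i < 2 ^ m" "d \<in> dom M" for i d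
    using that by (simp add: nat_eq_iff_bits[OF level_less that(1)] bit_level LJ)
  have type: "same_type l J (c (i, d)) (c (i', d')) \<longleftrightarrow> tp d = tp d'"
    if "i < 2 ^ m" "d \<in> dom M" "i' < 2 ^ m" "d' \<in> dom M" for i d i' d'
  proof -
    have "same_type l J (c (i, d)) (c (i', d')) \<longleftrightarrow>
        (\<forall>j<l. holds M \<pi>0 (\<lambda>_. d) (ds ! j) \<longleftrightarrow> holds M \<pi>0 (\<lambda>_. d') (ds ! j))"
      using that by (simp add: same_type_def EJ) (metis less_imp_le)
    also have "\<dots> \<longleftrightarrow> (\<forall>D\<in>set ds. holds M \<pi>0 (\<lambda>_. d) D \<longleftrightarrow> holds M \<pi>0 (\<lambda>_. d') D)"
      using ds(2) by (auto simp: all_set_conv_all_nth)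
    also have "\<dots> \<longleftrightarrow> tp d = tp d'"
      unfolding ds(1) tp_def by blast
    finally show ?thesis .
  qed
  have lay: "layered S M J m {..<2 ^ m} pr (\<lambda>i d. c (i, d))"
  proof
    fix i :: nat and p and us :: "'u list"
    assume i: "i \<in> {..<2 ^ m}" and "us \<noteq> []"
    \<comment> \<open>A nonempty copied tuple determines its level and its preimage.\<close>
    have "us = us' \<and> i = i'" if eq: "map (\<lambda>d. c (i, d)) us = map (\<lambda>d. c (i', d)) us'" for i' us'
    proof
      show "us = us'" using eq by (induction us arbitrary: us') (auto simp: Cons_eq_map_conv)
      then show "i = i'" using eq \<open>us \<noteq> []\<close> by (cases us) auto
    qed
    then show "map (\<lambda>d. c (i, d)) us \<in> pint J (Old p) \<longleftrightarrow> us \<in> pint (gamma M (pr i)) p"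
      using i unfolding OldJ by blast
  next
    fix i :: nat and d e
    assume "i \<in> {..<2 ^ m}" "d \<in> dom M" "e \<in> idom J"
    then show "same_level m J e (c (i, d)) \<longleftrightarrow> e \<in> (\<lambda>d. c (i, d)) ` dom M"
      by (auto simp: same_level_iff lev idom)
  qed (auto simp: idom inj_on_def)
  let ?D = "{g. Dia (Sym Star) g \<in> subfms f}"
  have fr: "frag S (tracks M ?D) f" by (rule frag_tracks[OF assms(4,5)])
  have ad: "layered.adequate M J l m {..<2 ^ m} pr (\<lambda>i d. c (i, d)) (rename f)"
  proof (rule adequate_rename[OF lay star fr])
    fix g d and i :: nat
    assume t: "tracks M ?D g" and i: "i \<in> {..<2 ^ m}" and d: "d \<in> dom M"
    \<comment> \<open>Types and witnesses refer to the diamonds of \<open>f\<close>, so the renamed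
      body is replaced by the body in \<open>f\<close> that it tracks.\<close>
    then obtain g' where g': "Dia (Sym Star) g' \<in> subfms f" "card (fv g') = card (fv g)"
        "\<And>\<pi> d. holds M \<pi> (\<lambda>_. d) g \<longleftrightarrow> holds M \<pi> (\<lambda>_. d) g'"
      by (auto simp: tracks_def)
    show "(\<exists>\<pi>\<in>precs M. holds M \<pi> (\<lambda>_. d) g) \<longleftrightarrow> (\<exists>j\<in>{..<2 ^ m}. \<exists>d'\<in>dom M.
        same_type l J (c (j, d')) (c (i, d)) \<and> holds M (pr j) (\<lambda>_. d') g)"
    proof
      assume "\<exists>\<pi>\<in>precs M. holds M \<pi> (\<lambda>_. d) g"
      then obtain j d' where "j < 2 ^ m" "d' \<in> dom M" "tp d' = tp d" "holds M (pr j) (\<lambda>_. d') g'"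
        using wit[rule_format, OF g'(1) d] g'(3) by blast
      then show "\<exists>j\<in>{..<2 ^ m}. \<exists>d'\<in>dom M.
          same_type l J (c (j, d')) (c (i, d)) \<and> holds M (pr j) (\<lambda>_. d') g"
        using type i d g'(3) by (intro bexI[of _ j] bexI[of _ d']) auto
    next
      assume "\<exists>j\<in>{..<2 ^ m}. \<exists>d'\<in>dom M.
          same_type l J (c (j, d')) (c (i, d)) \<and> holds M (pr j) (\<lambda>_. d') g"
      then obtain j d' where j: "j < 2 ^ m" "d' \<in> dom M" "tp d' = tp d" "holds M (pr j) (\<lambda>_. d') g'"
        using type i d g'(3) by auto
      then have dia: "\<exists>\<pi>\<in>precs M. holds M \<pi> (\<lambda>_. d') g'" using pr by blast
      \<comment> \<open>If the body has a free variable, its diamond belongs to the common type of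
        \<open>d'\<close> and \<open>d\<close>. If it is closed, its truth does not depend on the
        element at all.\<close>
      show "\<exists>\<pi>\<in>precs M. holds M \<pi> (\<lambda>_. d) g"
      proof (cases "card (fv g') = 1")
        case True
        then have "Dia (Sym Star) g' \<in> FreeDia_set f"
          using g'(1) by (simp add: FreeDia_set_def Dia_set_def)
        moreover have "holds M \<pi>0 (\<lambda>_. d') (Dia (Sym Star) g')" using dia star by simp
        ultimately have "Dia (Sym Star) g' \<in> tp d'" by (simp add: tp_def)
        then have "Dia (Sym Star) g' \<in> tp d" using j(3) by simp
        then have "holds M \<pi>0 (\<lambda>_. d) (Dia (Sym Star) g')" by (simp add: tp_def)
        then show ?thesis using g'(3) star by simp
      next
        case False
        then have "fv g' = {}" using t g'(2) by (auto simp: tracks_def le_Suc_eq)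
        then have "holds M \<pi> (\<lambda>_. d') g' \<longleftrightarrow> holds M \<pi> (\<lambda>_. d) g'" for \<pi>
          by (intro holds_cong) auto
        then show ?thesis using dia g'(3) by blast
      qed
    qed
  qed
  have frr: "frag S (\<lambda>g. tracks M ?D g \<and> mf g \<notin> outer_bound g) (rename f)"
    by (rule frag_rename[OF fr])
  have vars: "vars f \<subseteq> {X, Y}" "monodic f"
    using assms(5) by (auto simp: frugal_monodic_C2_def monodic_def)
  have fvr: "fv (rename f) = {}" using fv_rename[OF vars] assms(6) by simp
  have "fo_models J (FConj (FConj (stack S m) (rigE l)) (Trans l m (rename f)))"
    unfolding fo_models_def fo_holds.simps
  proof (intro allI impI conjI)
    fix w :: "var \<Rightarrow> 'u"
    have bin: "level m J x = level m J y"
      if p: "p \<in> preds S" and xy: "[x, y] \<in> pint J (Old p)" for p x y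
    proof -
      obtain i us where i: "[x, y] = map (\<lambda>d. c (i, d)) us" "i < 2 ^ m" "us \<in> pint (gamma M (pr i)) p"
        using xy unfolding OldJ mem_Collect_eq by (elim exE conjE)
      then have "set us \<subseteq> dom M" using pint_dom[OF i(3)] p pr by blast
      then show ?thesis using i(1,2) lev by (auto simp: map_eq_Cons_conv Cons_eq_map_conv)
    qed
    show "fo_holds J w (stack S m)"
      unfolding stack_iff[OF assms(2)]
    proof (intro conjI)
      show "\<forall>x\<in>idom J. level m J x \<noteq> 0 \<longrightarrow> (\<exists>!y. y \<in> idom J \<and> [y, x] \<in> pint J F)"
      proof (intro ballI impI)
        fix x assume x: "x \<in> idom J" "level m J x \<noteq> 0"
        from x(1) obtain i' d where d: "x = c (i', d)" "i' < 2 ^ m" "d \<in> dom M"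
          by (auto simp: idom)
        then obtain i where "i' = Suc i" using x(2) lev[OF d(2,3)] by (cases i') auto
        with d show "\<exists>!y. y \<in> idom J \<and> [y, x] \<in> pint J F"
          by (intro ex1I[of _ "c (i, d)"]) (auto simp: idom FJ)
      qed
    qed (use bin lev in \<open>auto simp: idom FJ\<close>)
    show "fo_holds J w (rigE l)"
      by (auto simp: rigE_def idom FJ type)
    have "\<And>a. holds M (pr a) (\<lambda>_. SOME d. d \<in> dom M) (rename f)"
      using M(2) pr ne(1) unfolding sp_models_def holds_rename[OF vars]
      by (auto simp: some_in_eq image_subset_iff)
    then show "fo_holds J w (Trans l m (rename f))"
      using layered.Trans_iff[OF lay ad fvr frag_outer_bound[OF frr] ne(1)] by blast
  qed
  then show ?thesis using wfJ unfolding fo_satisfiable_def by blast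
qed

section \<open>From levels to precisifications\<close>

text \<open>\<open>F\<close> is a type-preserving bijection between consecutive levels, and
  \<open>h i\<close> composes the first \<open>i\<close> of them. So the elements of level 0 can
  stand for whole stacks.\<close>

lemma ex_chains:
  fixes I :: "('e, 'p xpred, 'c) interp"
  assumes "wf_interp (xsig l m S) I" "finite (preds S)"
    and "fo_models I (stack S m)" "fo_models I (rigE l)"
  defines "B \<equiv> {d \<in> idom I. level m I d = 0}"
  shows "B \<noteq> {} \<and> (\<exists>h. \<forall>i<2 ^ m. bij_betw (h i) B {e \<in> idom I. level m I e = i} \<and>
    (\<forall>d\<in>B. same_type l I (h i d) d))"
proof -
  obtain e0 where e0: "e0 \<in> idom I" using assms(1) by (auto simp: wf_interp_def)
  then have w: "range (\<lambda>_ :: var. e0) \<subseteq> idom I" by auto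
  have "fo_holds I (\<lambda>_. e0) (stack S m)" using assms(3) w unfolding fo_models_def by blast
  note st = this[unfolded stack_iff[OF assms(2)]]
  note ex_succ = st[THEN conjunct1, rule_format]
    and no_succ = st[THEN conjunct2, THEN conjunct1, rule_format]
    and ex_pred = st[THEN conjunct2, THEN conjunct2, THEN conjunct1, rule_format]
    and incr = st[THEN conjunct2, THEN conjunct2, THEN conjunct2, THEN conjunct2, THEN conjunct1,
      rule_format]
  have "fo_holds I (\<lambda>_. e0) (rigE l)" using assms(4) w unfolding fo_models_def by blast
  then have rig: "same_type l I x y" if "x \<in> idom I" "y \<in> idom I" "[x, y] \<in> pint I F" for x y
    using that by (auto simp: rigE_def)
  define lay where "lay i = {e \<in> idom I. level m I e = i}" for i
  \<comment> \<open>An increment modulo \<open>2 ^ m\<close> is a true increment here, since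
    elements of the top level have no successor.\<close>
  have up: "level m I y = Suc (level m I x)"
    if "x \<in> idom I" "y \<in> idom I" "[x, y] \<in> pint I F" for x y
  proof -
    have "Suc (level m I x) \<noteq> 2 ^ m" using no_succ[OF that(1)] that by blast
    then have "Suc (level m I x) < 2 ^ m" using level_less[of m I x] by linarith
    from nat_eq_iff_bits[OF level_less[of m I y] this] show ?thesis using incr[OF that] by simp
  qed
  have step: "\<exists>s. bij_betw s (lay i) (lay (Suc i)) \<and> (\<forall>x\<in>lay i. same_type l I (s x) x)"
    if i: "Suc i < 2 ^ m" for i
  proof -
    have succ: "\<exists>!y. y \<in> idom I \<and> [x, y] \<in> pint I F" if "x \<in> lay i" for x
      using ex_succ[of x] that i by (simp add: lay_def)
    have pred: "\<exists>!x. x \<in> idom I \<and> [x, y] \<in> pint I F" if "y \<in> lay (Suc i)" for y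
      using ex_pred[of y] that by (simp add: lay_def)
    have "\<forall>x\<in>lay i. \<exists>y. y \<in> idom I \<and> [x, y] \<in> pint I F"
      using succ by (intro ballI ex1_implies_ex)
    then obtain s where s: "\<And>x. x \<in> lay i \<Longrightarrow> s x \<in> idom I" "\<And>x. x \<in> lay i \<Longrightarrow> [x, s x] \<in> pint I F"
      by metis
    have sl: "s x \<in> lay (Suc i)" if "x \<in> lay i" for x
      using s[OF that] up[of x "s x"] that by (auto simp: lay_def)
    have "inj_on s (lay i)"
    proof (rule inj_onI)
      fix x x' assume x: "x \<in> lay i" "x' \<in> lay i" "s x = s x'"
      have "[x, s x] \<in> pint I F" "[x', s x] \<in> pint I F" using s x by metis+
      moreover have "x \<in> idom I" "x' \<in> idom I" using x by (auto simp: lay_def)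
      ultimately show "x = x'" using pred[OF sl[OF x(1)]] by blast
    qed
    moreover have "lay (Suc i) \<subseteq> s ` lay i"
    proof
      fix y assume y: "y \<in> lay (Suc i)"
      then obtain x where x: "x \<in> idom I" "[x, y] \<in> pint I F" using pred by blast
      have yi: "y \<in> idom I" using y by (simp add: lay_def)
      then have xl: "x \<in> lay i" using up[OF x(1) yi x(2)] y x(1) by (simp add: lay_def)
      then have "y = s x" using succ[OF xl] s[OF xl] x(2) yi by blast
      then show "y \<in> s ` lay i" using xl by blast
    qed
    ultimately have "bij_betw s (lay i) (lay (Suc i))" using sl by (auto simp: bij_betw_def)
    moreover have "same_type l I (s x) x" if "x \<in> lay i" for x
      using rig[of x "s x"] s[OF that] that same_type_sym[of l I] by (simp add: lay_def)
    ultimately show ?thesis by blast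
  qed
  have B: "B = lay 0" by (simp add: B_def lay_def)
  have chain: "\<exists>g. bij_betw g B (lay i) \<and> (\<forall>d\<in>B. same_type l I (g d) d)" if "i < 2 ^ m" for i
    using that
  proof (induction i)
    case 0
    show ?case by (intro exI[of _ id]) (simp add: B bij_betw_def same_type_refl)
  next
    case (Suc i)
    then obtain g s where g: "bij_betw g B (lay i)" "\<forall>d\<in>B. same_type l I (g d) d"
      and s: "bij_betw s (lay i) (lay (Suc i))" "\<forall>x\<in>lay i. same_type l I (s x) x"
      using step[OF Suc.prems] by auto
    have "same_type l I ((s \<circ> g) d) d" if "d \<in> B" for d
      using same_type_trans[of l I "s (g d)" "g d" d] g s that by (auto simp: bij_betw_def)
    then show ?case using bij_betw_trans[OF g(1) s(1)] by blast
  qed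
  \<comment> \<open>Some element exists on some level, and its stack reaches down to level
    0.\<close>
  have "B \<noteq> {}"
  proof -
    obtain g where "bij_betw g B (lay (level m I e0))" using chain[OF level_less[of m I e0]] by auto
    moreover have "e0 \<in> lay (level m I e0)" using e0 by (simp add: lay_def)
    ultimately show ?thesis by (auto simp: bij_betw_def)
  qed
  moreover have "\<exists>h. \<forall>i<2 ^ m. bij_betw (h i) B (lay i) \<and> (\<forall>d\<in>B. same_type l I (h i d) d)"
    using chain by (intro choice allI) simp
  ultimately show ?thesis by (simp add: lay_def)
qed

text \<open>Transpositions act transitively on the stacks of each type, which is all that diamonds need,
  and, unlike all type-preserving permutations, they are few enough to be coded into \<open>'u\<close>.\<close>

lemma sp_satisfiable_if_fo_satisfiable:
  fixes f :: "('p, 'c, 's) fm" and S :: "('p, 'c, 's) sp_sig"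
  assumes "infinite (UNIV :: 'u set)" "finite (preds S)" "cnsts S = {}"
    and "wf_fm S f" "frugal_monodic_C2 S f" "fv f = {}"
    and "fo_satisfiable TYPE('u) (xsig l m S)
      (FConj (FConj (stack S m) (rigE l)) (Trans l m (rename f)))"
  shows "sp_satisfiable TYPE('u) S f"
proof -
  obtain I :: "('u, 'p xpred, 'c) interp" where I: "wf_interp (xsig l m S) I"
      "fo_models I (stack S m)" "fo_models I (rigE l)" "fo_models I (Trans l m (rename f))"
    using assms(7) unfolding fo_satisfiable_def fo_models_def fo_holds.simps by blast
  define B where "B = {d \<in> idom I. level m I d = 0}"
  obtain h where B: "B \<noteq> {}"
    and h: "\<And>i. i < 2 ^ m \<Longrightarrow> bij_betw (h i) B {e \<in> idom I. level m I e = i}"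
      "\<And>i d. i < 2 ^ m \<Longrightarrow> d \<in> B \<Longrightarrow> same_type l I (h i d) d"
    using ex_chains[OF I(1) assms(2) I(2,3)] unfolding B_def by blast
  obtain c1 :: "nat \<times> 'u \<Rightarrow> 'u" and c2 :: "'u \<times> 'u \<Rightarrow> 'u" where c12: "inj c1" "inj c2"
    using infinite_nat_pair_inj[OF assms(1)] infinite_pair_inj[OF assms(1)] by blast
  define c where "c = (\<lambda>(i :: nat, ab). c1 (i, c2 ab))"
  have c: "inj c" by (auto simp: c_def inj_def inj_eq[OF c12(1)] inj_eq[OF c12(2)])
  \<comment> \<open>The index \<open>(i, a, b)\<close> stands for level \<open>i\<close> with the
    stacks of \<open>a\<close> and \<open>b\<close> exchanged; \<open>(i, d, d)\<close> leaves the
    level as it is.\<close>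
  define A where "A = {(i :: nat, a, b). i < 2 ^ m \<and> a \<in> B \<and> b \<in> B \<and> same_type l I a b}"
  define sw where "sw = (\<lambda>(a, b) (d :: 'u). if d = a then b else if d = b then a else d)"
  define k where "k = (\<lambda>(i, ab) d. h i (sw ab d))"
  \<comment> \<open>\<open>inv c\<close> decodes a precisification to its index, and predicates are
    pulled back from the level along \<open>k\<close>.\<close>
  define M :: "('u, 'u, 'p, 'c, 's) sp_struct" where "M =
    \<lparr>dom = B, precs = c ` A, sigma = (\<lambda>_. c ` A),
     gamma = (\<lambda>\<pi>. \<lparr>idom = B,
       pint = (\<lambda>p. {us. set us \<subseteq> B \<and> length us = arity S p \<and> map (k (inv c \<pi>)) us \<in> pint I (Old p)}),
       cint = undefined\<rparr>)\<rparr>"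
  have M: "dom M = B" "precs M = c ` A" "sigma M Star = precs M"
    by (simp_all add: M_def)
  have pintM: "pint (gamma M (c a)) p =
      {us. set us \<subseteq> B \<and> length us = arity S p \<and> map (k a) us \<in> pint I (Old p)}" for a p
    using c by (simp add: M_def)
  have inA: "(i, d, d) \<in> A" if "i < 2 ^ m" "d \<in> B" for i d
    using that by (simp add: A_def same_type_refl)
  obtain d0 where d0: "d0 \<in> B" using B by auto
  have A: "A \<noteq> {}" using inA[OF _ d0, of 0] by auto
  have wfM: "wf_struct S M"
    using A B assms(3) by (auto simp: wf_struct_def wf_interp_def M_def)
  have bij_sw: "bij_betw (sw ab) B B" if "(i, ab) \<in> A" for i ab
    by (rule bij_betw_byWitness[where f' = "sw ab"])
      (use that in \<open>auto simp: sw_def A_def split: prod.splits\<close>)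
  have type_sw: "same_type l I (sw ab d) d" if "(i, ab) \<in> A" "d \<in> B" for i ab d
    using that by (auto simp: sw_def A_def same_type_sym[of l I] same_type_refl split: prod.splits)
  have bij_k: "bij_betw (k (i, ab)) B {e \<in> idom I. level m I e = i}" if "(i, ab) \<in> A" for i ab
  proof -
    have "i < 2 ^ m" using that by (auto simp: A_def)
    then show ?thesis
      using bij_betw_trans[OF bij_sw[OF that] h(1)] by (simp add: k_def comp_def)
  qed
  have type_k: "same_type l I (k a d) d" if "a \<in> A" "d \<in> B" for a d
  proof -
    obtain i ab where a: "a = (i, ab)" by (cases a)
    have "i < 2 ^ m" using that a by (auto simp: A_def)
    moreover have "sw ab d \<in> B" using bij_betwE[OF bij_sw, of i ab] that a by simp
    ultimately show ?thesis
      using h(2) type_sw[of i ab d] that same_type_trans[of l I "k a d" "sw ab d" d]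
      by (simp add: a k_def)
  qed
  \<comment> \<open>Many indices share a level, one for each transposition. The image of
    \<open>k a\<close> is the whole level in each case.\<close>
  have lay: "layered S M I m A c k"
  proof
    fix a assume "a \<in> A"
    then show "inj_on (k a) (dom M)" using bij_k by (cases a) (auto simp: bij_betw_def M)
  next
    show "idom I = (\<Union>a\<in>A. k a ` dom M)"
    proof (intro equalityI subsetI)
      fix e assume e: "e \<in> idom I"
      let ?a = "(level m I e, d0, d0)"
      have a: "?a \<in> A" by (intro inA level_less d0)
      then have "e \<in> k ?a ` B" using bij_betw_imp_surj_on[OF bij_k[OF a]] e by simp
      then show "e \<in> (\<Union>a\<in>A. k a ` dom M)" unfolding M by (rule UN_I[OF a])
    next
      fix e assume "e \<in> (\<Union>a\<in>A. k a ` dom M)"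
      then obtain i ab where a: "(i, ab) \<in> A" "e \<in> k (i, ab) ` B" by (auto simp: M)
      then show "e \<in> idom I" using bij_betw_imp_surj_on[OF bij_k[OF a(1)]] by simp
    qed
  next
    fix a d e
    assume a: "a \<in> A" and d: "d \<in> dom M" and e: "e \<in> idom I"
    obtain i ab where i: "a = (i, ab)" by (cases a)
    have im: "k a ` B = {e \<in> idom I. level m I e = i}"
      using bij_betw_imp_surj_on[OF bij_k[of i ab]] a i by simp
    then have "level m I (k a d) = i" using d M by blast
    then show "same_level m I e (k a d) \<longleftrightarrow> e \<in> k a ` dom M"
      using im e by (simp add: same_level_iff M)
  next
    fix a p us
    assume "length us = arity S p" "set us \<subseteq> dom M"
    then show "map (k a) us \<in> pint I (Old p) \<longleftrightarrow> us \<in> pint (gamma M (c a)) p"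
      by (simp add: pintM M)
  qed
  let ?D = "{g. Dia (Sym Star) g \<in> subfms f}"
  have fr: "frag S (tracks M ?D) f" by (rule frag_tracks[OF assms(4,5)])
  have ad: "layered.adequate M I l m A c k (rename f)"
  proof (rule adequate_rename[OF lay M(3) fr])
    fix g a d
    assume const: "\<And>b d' e w. b \<in> A \<Longrightarrow> d' \<in> dom M \<Longrightarrow> e \<in> idom I \<Longrightarrow>
        fo_holds I (w(nf g := e, mf g := k b d')) (tr l m g) \<longleftrightarrow> holds M (c b) (\<lambda>_. d') g"
      and a: "a \<in> A" and d: "d \<in> dom M"
    show "(\<exists>\<pi>\<in>precs M. holds M \<pi> (\<lambda>_. d) g) \<longleftrightarrow>
      (\<exists>b\<in>A. \<exists>d'\<in>dom M. same_type l I (k b d') (k a d) \<and> holds M (c b) (\<lambda>_. d') g)"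
    proof
      \<comment> \<open>The same element and precisification serve as witness, since all copies of
        \<open>d\<close> have one type.\<close>
      assume "\<exists>\<pi>\<in>precs M. holds M \<pi> (\<lambda>_. d) g"
      then obtain b where "b \<in> A" "holds M (c b) (\<lambda>_. d) g" by (auto simp: M)
      moreover have "same_type l I (k b d) (k a d)" if "b \<in> A" for b
        using type_k[OF that] type_k[OF a] d same_type_trans same_type_sym M(1) by metis
      ultimately show "\<exists>b\<in>A. \<exists>d'\<in>dom M. same_type l I (k b d') (k a d) \<and> holds M (c b) (\<lambda>_. d') g"
        using d by blast
    next
      assume "\<exists>b\<in>A. \<exists>d'\<in>dom M. same_type l I (k b d') (k a d) \<and> holds M (c b) (\<lambda>_. d') g"
      then obtain i ab d' where b: "(i, ab) \<in> A" "d' \<in> B" "same_type l I (k (i, ab) d') (k a d)"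
          "holds M (c (i, ab)) (\<lambda>_. d') g"
        by (auto simp: M)
      have dB: "d \<in> B" using d M by simp
      have i: "i < 2 ^ m" using b by (auto simp: A_def)
      \<comment> \<open>The element satisfying \<open>g\<close> lies on the stack of
        \<open>sw ab d'\<close>. This stack has the type of \<open>d\<close>, so exchanging it with
        the stack of \<open>d\<close> is a permitted transposition.\<close>
      have sB: "sw ab d' \<in> B" using bij_betwE[OF bij_sw[OF b(1)]] b(2) by simp
      have "same_type l I d (sw ab d')"
        using type_k[OF b(1,2)] type_k[OF a dB] type_sw[OF b(1,2)] b(3)
          same_type_trans same_type_sym by metis
      then have A': "(i, d, sw ab d') \<in> A" using i dB sB by (simp add: A_def)
      \<comment> \<open>The new transposition moves \<open>d\<close> to the very element of
        \<open>I\<close> that was the copy of \<open>d'\<close>, so \<open>const\<close> gives both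
        the same truth value of \<open>g\<close>.\<close>
      have keq: "k (i, d, sw ab d') d = k (i, ab) d'" by (simp add: k_def sw_def)
      obtain e where e: "e \<in> idom I" using I(1) by (auto simp: wf_interp_def)
      have "holds M (c (i, d, sw ab d')) (\<lambda>_. d) g"
        using const[OF A' d e, of "\<lambda>_. e"] const[OF b(1) _ e, of d' "\<lambda>_. e"] b keq M by simp
      then show "\<exists>\<pi>\<in>precs M. holds M \<pi> (\<lambda>_. d) g" using A' M by auto
    qed
  qed
  have frr: "frag S (\<lambda>g. tracks M ?D g \<and> mf g \<notin> outer_bound g) (rename f)"
    by (rule frag_rename[OF fr])
  have vars: "vars f \<subseteq> {X, Y}" "monodic f"
    using assms(5) by (auto simp: frugal_monodic_C2_def monodic_def)
  have fvr: "fv (rename f) = {}" using fv_rename[OF vars] assms(6) by simp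
  obtain e where e: "e \<in> idom I" using I(1) by (auto simp: wf_interp_def)
  then have "fo_holds I (\<lambda>_. e) (Trans l m (rename f))"
    using I(4) by (auto simp: fo_models_def)
  then have "\<forall>a\<in>A. holds M (c a) v f" for v
    using layered.Trans_iff[OF lay ad fvr frag_outer_bound[OF frr], of "\<lambda>_. e" v] B
    unfolding holds_rename[OF vars] M by blast
  then have "sp_models M f" by (auto simp: sp_models_def M)
  then show ?thesis using wfM unfolding sp_satisfiable_def by blast
qed

theorem theorem6:
  fixes P :: "'p set" and ar :: "'p \<Rightarrow> nat" and \<phi> :: "('p, 'c, 's) fm"
  defines "S \<equiv> \<lparr>preds = P, arity = ar, cnsts = {}, stps = {Star}\<rparr>"
  defines "l \<equiv> card (FreeDia_set \<phi>)"
  defines "m \<equiv> num_bits \<phi>"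
  assumes "infinite (UNIV :: 'u set)"
    and "finite P"
    and "wf_fm S \<phi>"
    and "frugal_monodic_C2 S \<phi>"
    and "fv \<phi> = {}"
  shows "sp_satisfiable TYPE('u) S \<phi> \<longleftrightarrow>
    fo_satisfiable TYPE('u) (xsig l m S)
      (FConj (FConj (stack S m) (rigE l)) (Trans l m (rename \<phi>)))"
proof -
  have S: "finite (preds S)" "cnsts S = {}" using assms(5) by (simp_all add: S_def)
  show ?thesis
    using fo_satisfiable_if_sp_satisfiable[OF assms(4) S assms(6-8)]
      sp_satisfiable_if_fo_satisfiable[OF assms(4) S assms(6-8)]
    unfolding l_def m_def by blast
qed

end
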